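(* Let $\Omega\Subset\mathbb{C}^{n}$, $n\geq 1$, be a bounded domain with smooth ($\mathcal{C}^{\infty}$) boundary. Let $\delta\in\mathcal{C}^{\infty}(\overline{\Omega})$ be a function which equals the distance-to-the-boundary function $d_{b\Omega}$ of $\Omega$ near $b\Omega$. Let $k\in\mathbb{N}$ and $g\in\mathcal{C}^{\infty}(\overline{\Omega})$ be given. Then there exists a function $\omega_{k,g}\in\mathcal{C}^{\infty}(\overline{\Omega})$ such that $$\int_{\Omega}\eta\cdot g\,dV=\int_{\Omega}\delta^{k}\cdot\omega_{k,g}\cdot\eta\,dV\qquad\text{for all }\eta\in L^{1}(\Omega)\cap\mathcal{O}(\Omega).$$
   Context: $b\Omega$ is the boundary of $\Omega$; $d_{b\Omega}(z)=\inf\{\|z-w\|: w\in b\Omega\}$ with $\|\cdot\|$ the Euclidean norm on $\mathbb{C}^n$. "Near $b\Omega$" means on $\overline{\Omega}\cap U$ for some open neighborhood $U$ of $b\Omega$. $\mathcal{C}^{\infty}(\overline{\Omega})$ is the space of (complex-valued) functions on $\Omega$ which are smooth up to the boundary. $\mathcal{O}(\Omega)$ is the space of holomorphic functions on $\Omega$. $dV$ is the Euclidean volume form, and $L^{1}(\Omega)$ is taken with respect to it. $\mathbb{N}=\{1,2,3,\dots\}$. *)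

theory Defs
  imports "HOL-Analysis.Analysis"
begin

text \<open>Iterated directional (Frechet) derivatives over the reals; the last vector of the list is
  differentiated along first.  For functions on \<open>\<complex>\<^sup>n\<close> the directions range over the whole real
  vector space \<open>\<complex>\<^sup>n = \<real>\<^sup>2\<^sup>n\<close>, so these include all mixed real partial derivatives.\<close>

primrec iter_deriv :: "'a::real_normed_vector list \<Rightarrow> ('a \<Rightarrow> 'b::real_normed_vector) \<Rightarrow> 'a \<Rightarrow> 'b" where
  "iter_deriv [] f = f"
| "iter_deriv (v # vs) f = (\<lambda>x. frechet_derivative (iter_deriv vs f) (at x) v)"

text \<open>Meant for open \<open>S\<close> in a finite-dimensional space, where differentiability of all iterated
  directional derivatives (hence their continuity) is the usual \<open>C\<^sup>\<infinity>\<close>.\<close>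

definition smooth_on :: "'a::real_normed_vector set \<Rightarrow> ('a \<Rightarrow> 'b::real_normed_vector) \<Rightarrow> bool" where
  "smooth_on S f \<longleftrightarrow> (\<forall>vs. \<forall>x\<in>S. iter_deriv vs f differentiable (at x))"

text \<open>\<open>f \<in> C\<^sup>\<infinity>(closure \<Omega>)\<close> for open \<open>\<Omega>\<close>: \<open>f\<close> is smooth on \<open>\<Omega>\<close> and every iterated
  derivative has a continuous extension to the closure.  Only the values of \<open>f\<close> on \<open>\<Omega>\<close> matter.\<close>

definition smooth_up_to_boundary ::
    "'a::real_normed_vector set \<Rightarrow> ('a \<Rightarrow> 'b::real_normed_vector) \<Rightarrow> bool" where
  "smooth_up_to_boundary \<Omega> f \<longleftrightarrow> smooth_on \<Omega> f \<and>
     (\<forall>vs. \<exists>F. continuous_on (closure \<Omega>) F \<and> (\<forall>x\<in>\<Omega>. F x = iter_deriv vs f x))"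

text \<open>Each boundary point has a local smooth defining function with non-vanishing differential;
  in particular \<open>\<Omega>\<close> lies locally on one side of its boundary.\<close>

definition smooth_boundary :: "'a::real_normed_vector set \<Rightarrow> bool" where
  "smooth_boundary \<Omega> \<longleftrightarrow> (\<forall>p\<in>frontier \<Omega>. \<exists>V. \<exists>r :: 'a \<Rightarrow> real.
     open V \<and> p \<in> V \<and> smooth_on V r \<and> \<Omega> \<inter> V = {z \<in> V. r z < 0} \<and>
     frechet_derivative r (at p) \<noteq> (\<lambda>_. 0))"

definition smooth_bounded_domain :: "'a::real_normed_vector set \<Rightarrow> bool" where
  "smooth_bounded_domain \<Omega> \<longleftrightarrow>
     open \<Omega> \<and> connected \<Omega> \<and> \<Omega> \<noteq> {} \<and> bounded \<Omega> \<and> smooth_boundary \<Omega>"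

text \<open>Holomorphy in several variables on an open set: the real Frechet derivative exists at every
  point and is complex linear.\<close>

definition holomorphic_on_vec :: "(complex ^ 'n \<Rightarrow> complex) \<Rightarrow> (complex ^ 'n) set \<Rightarrow> bool" where
  "holomorphic_on_vec f \<Omega> \<longleftrightarrow>
     (\<forall>z\<in>\<Omega>. \<exists>D. (f has_derivative D) (at z) \<and> (\<forall>c v. D (c *s v) = c * D v))"

end

theory Submission
  imports Defs "HOL-Complex_Analysis.Cauchy_Integral_Formula"
begin

text \<open>Near the boundary \<open>\<delta>\<close> is the boundary distance, so \<open>|\<nabla>\<delta>| = 1\<close>, that is,
  \<open>\<Sum>\<^sub>j \<phi>\<^sub>j D\<^sub>j \<delta> = 1\<close> there, where \<open>D\<^sub>j\<close> is the \<open>j\<close>-th Cauchy--Riemann derivative and \<open>\<phi>\<^sub>j\<close>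
  is four times the \<open>j\<close>-th holomorphic derivative of \<open>\<delta>\<close>.  If \<open>h\<close> is supported in this collar, then
  \<open>\<delta>\<^sup>m h = (m+1)\<^sup>-\<^sup>1 \<Sum>\<^sub>j \<phi>\<^sub>j h D\<^sub>j \<delta>\<^sup>m\<^sup>+\<^sup>1\<close>, and integrating by parts against a holomorphic \<open>\<eta>\<close>, which is
  killed by every \<open>D\<^sub>j\<close>, replaces \<open>\<delta>\<^sup>m h\<close> by \<open>\<delta>\<^sup>m\<^sup>+\<^sup>1 h'\<close> with \<open>h'\<close> supported in the same collar; no
  boundary term appears because \<open>\<delta>\<^sup>m\<^sup>+\<^sup>1\<close> vanishes on the boundary.  Iterating gives any power of
  \<open>\<delta>\<close> once \<open>g\<close> has been replaced by a function supported in the collar.  For the latter, solve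
  \<open>D\<^sub>1 \<phi> = \<kappa> g\<close> by a Cauchy transform, where the cutoff \<open>\<kappa>\<close> is compactly supported in \<open>\<Omega>\<close> and
  equals 1 off the collar, and take \<open>g - D\<^sub>1 (\<kappa> \<phi>)\<close>.\<close>

section \<open>Algebra of functions smooth up to the boundary\<close>

text \<open>Regularity of the distance near the boundary is inherited from \<open>\<delta>\<close>,
  with which it coincides there; a cutoff that is a function of the distance is therefore smooth up
  to the boundary as soon as it is constant off the collar. The obstacle is that \<eta> is merely
  integrable and has no boundary values, so Stokes' theorem on \<Omega> makes no sense for it. Each
  integration by parts is instead carried out for a compactly supported Lipschitz function on the
  whole space, where it follows from translation invariance of Lebesgue measure, and the boundary is
  reached only by exhausting \<Omega> with cutoffs. The equation
  \<open>D\<^sub>1 \<phi> = \<kappa> g\<close> involves a single Cauchy-Riemann derivative, so it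
  can be solved on parallel complex lines with the remaining variables as parameters, and no
  compatibility condition arises. Control of infinitely many derivatives is always obtained by
  coinduction: one exhibits a family of functions that differentiation maps into itself, possibly up
  to sums and products.\<close>

lemma frechet_derivative_cong_open:
  assumes "open S" "x \<in> S" "\<And>y. y \<in> S \<Longrightarrow> f y = g y"
  shows "frechet_derivative f (at x) = frechet_derivative g (at x)"
proof -
  have "(f has_derivative D) (at x) \<longleftrightarrow> (g has_derivative D) (at x)" for D
    using assms has_derivative_transform_within_open[of f D x UNIV S g]
      has_derivative_transform_within_open[of g D x UNIV S f] by auto
  then show ?thesis by (simp add: frechet_derivative_def)
qed

lemma differentiable_cong_open:
  assumes "open S" "x \<in> S" "\<And>y. y \<in> S \<Longrightarrow> f y = g y" "f differentiable (at x)"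
  shows "g differentiable (at x)"
  using assms has_derivative_transform_within_open[of f _ x UNIV S g]
  unfolding differentiable_def by auto

lemma iter_deriv_cong_open:
  assumes "open S" "\<And>y. y \<in> S \<Longrightarrow> f y = g y" "x \<in> S"
  shows "iter_deriv vs f x = iter_deriv vs g x"
  using assms(3)
proof (induction vs arbitrary: x)
  case Nil
  then show ?case using assms by simp
next
  case (Cons v vs)
  then show ?case
    using frechet_derivative_cong_open[OF assms(1) Cons.prems, of "iter_deriv vs f" "iter_deriv vs g"]
    by simp
qed

lemma iter_deriv_append: "iter_deriv (vs @ ws) f = iter_deriv vs (iter_deriv ws f)"
  by (induction vs) auto

text \<open>By induction on the list of directions every iterated derivative agrees on
  \<open>S\<close> with some member of \<open>A\<close>, and membership supplies differentiability
  and the extension. Agreement on \<open>S\<close> is enough because a derivative on an open set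
  sees no values outside it.\<close>

lemma smooth_up_to_boundary_coinduct:
  assumes "open S" and "A f"
    and diff: "\<And>f x. A f \<Longrightarrow> x \<in> S \<Longrightarrow> f differentiable (at x)"
    and ext: "\<And>f. A f \<Longrightarrow> \<exists>F. continuous_on (closure S) F \<and> (\<forall>x\<in>S. F x = f x)"
    and deriv: "\<And>f v. A f \<Longrightarrow> \<exists>g. A g \<and> (\<forall>x\<in>S. frechet_derivative f (at x) v = g x)"
  shows "smooth_up_to_boundary S f"
proof -
  have *: "\<exists>g. A g \<and> (\<forall>x\<in>S. iter_deriv vs f x = g x)" for vs
  proof (induction vs)
    case Nil
    then show ?case using assms by auto
  next
    case (Cons v vs)
    then obtain g where g: "A g" "\<forall>x\<in>S. iter_deriv vs f x = g x" by blast
    obtain h where h: "A h" "\<forall>x\<in>S. frechet_derivative g (at x) v = h x"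
      using deriv[OF g(1)] by blast
    have "iter_deriv (v # vs) f x = h x" if "x \<in> S" for x
      using frechet_derivative_cong_open[OF \<open>open S\<close> that, of "iter_deriv vs f" g] g h that by simp
    with h show ?case by blast
  qed
  show ?thesis
    unfolding smooth_up_to_boundary_def smooth_on_def
  proof (intro conjI allI ballI)
    fix vs x assume "x \<in> S"
    obtain g where g: "A g" "\<forall>x\<in>S. iter_deriv vs f x = g x" using * by blast
    show "iter_deriv vs f differentiable (at x)"
      by (rule differentiable_cong_open[OF \<open>open S\<close> \<open>x \<in> S\<close> _ diff[OF g(1) \<open>x \<in> S\<close>]]) (use g in auto)
  next
    fix vs
    obtain g where g: "A g" "\<forall>x\<in>S. iter_deriv vs f x = g x" using * by blast
    then show "\<exists>F. continuous_on (closure S) F \<and> (\<forall>x\<in>S. F x = iter_deriv vs f x)"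
      using ext[OF g(1)] by auto
  qed
qed

text \<open>The Leibniz and chain rules turn a generator such as \<open>1/u\<close> or a cutoff into
  products of generators, so a natural family of generators is often not closed under
  differentiation while the algebra it generates is.\<close>

inductive alg_hull ::
    "(('a \<Rightarrow> 'b) \<Rightarrow> bool) \<Rightarrow> ('a::real_normed_vector \<Rightarrow> 'b::real_normed_algebra) \<Rightarrow> bool"
  for A where
  base: "A f \<Longrightarrow> alg_hull A f"
| const: "alg_hull A (\<lambda>_. c)"
| add: "alg_hull A f \<Longrightarrow> alg_hull A g \<Longrightarrow> alg_hull A (\<lambda>x. f x + g x)"
| mult: "alg_hull A f \<Longrightarrow> alg_hull A g \<Longrightarrow> alg_hull A (\<lambda>x. f x * g x)"

lemma frechet_derivative_add:
  assumes "f differentiable (at x)" "g differentiable (at x)"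
  shows "frechet_derivative (\<lambda>x. f x + g x) (at x) v
    = frechet_derivative f (at x) v + frechet_derivative g (at x) v"
proof -
  have "((\<lambda>x. f x + g x) has_derivative
      (\<lambda>v. frechet_derivative f (at x) v + frechet_derivative g (at x) v)) (at x)"
    using assms by (intro has_derivative_add) (auto simp: frechet_derivative_works[symmetric])
  then show ?thesis by (rule frechet_derivative_at[THEN fun_cong, symmetric])
qed

lemma frechet_derivative_times:
  fixes f g :: "'a::real_normed_vector \<Rightarrow> 'b::real_normed_algebra"
  assumes "f differentiable (at x)" "g differentiable (at x)"
  shows "frechet_derivative (\<lambda>x. f x * g x) (at x) v
    = f x * frechet_derivative g (at x) v + frechet_derivative f (at x) v * g x"
proof -
  have "((\<lambda>x. f x * g x) has_derivative
      (\<lambda>v. f x * frechet_derivative g (at x) v + frechet_derivative f (at x) v * g x)) (at x)"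
    using assms by (intro has_derivative_mult) (auto simp: frechet_derivative_works[symmetric])
  then show ?thesis by (rule frechet_derivative_at[THEN fun_cong, symmetric])
qed

text \<open>The derivative of a generator need only lie in the algebra hull, so this is coinduction up
  to the algebra operations.\<close>

lemma smooth_up_to_boundary_alg_hull:
  fixes f :: "'a::real_normed_vector \<Rightarrow> 'b::real_normed_algebra"
  assumes "open S" and "alg_hull A f"
    and diff: "\<And>f x. A f \<Longrightarrow> x \<in> S \<Longrightarrow> f differentiable (at x)"
    and ext: "\<And>f. A f \<Longrightarrow> \<exists>F. continuous_on (closure S) F \<and> (\<forall>x\<in>S. F x = f x)"
    and deriv: "\<And>f v. A f \<Longrightarrow> \<exists>g. alg_hull A g \<and> (\<forall>x\<in>S. frechet_derivative f (at x) v = g x)"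
  shows "smooth_up_to_boundary S f"
proof (rule smooth_up_to_boundary_coinduct[of S "alg_hull A"])
  show diff': "f differentiable (at x)" if "alg_hull A f" "x \<in> S" for f x
    using that by (induction) (auto simp: diff)
  show "\<exists>F. continuous_on (closure S) F \<and> (\<forall>x\<in>S. F x = f x)" if "alg_hull A f" for f
    using that
  proof induction
    case (const c)
    then show ?case by (intro exI[of _ "\<lambda>_. c"]) auto
  next
    case (add f g)
    then obtain F G where "continuous_on (closure S) F" "\<forall>x\<in>S. F x = f x"
      "continuous_on (closure S) G" "\<forall>x\<in>S. G x = g x" by blast
    then show ?case by (intro exI[of _ "\<lambda>x. F x + G x"]) (auto intro!: continuous_intros)
  next
    case (mult f g)
    then obtain F G where "continuous_on (closure S) F" "\<forall>x\<in>S. F x = f x"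
      "continuous_on (closure S) G" "\<forall>x\<in>S. G x = g x" by blast
    then show ?case by (intro exI[of _ "\<lambda>x. F x * G x"]) (auto intro!: continuous_intros)
  next
    case (base f)
    then show ?case by (rule ext)
  qed
  show "\<exists>g. alg_hull A g \<and> (\<forall>x\<in>S. frechet_derivative f (at x) v = g x)" if "alg_hull A f" for f v
    using that
  proof induction
    case (const c)
    then show ?case by (intro exI[of _ "\<lambda>_. 0"]) (auto intro: alg_hull.const)
  next
    case (add f g)
    then obtain F G where "alg_hull A F" "\<forall>x\<in>S. frechet_derivative f (at x) v = F x"
      "alg_hull A G" "\<forall>x\<in>S. frechet_derivative g (at x) v = G x" by blast
    then show ?case using add.hyps
      by (intro exI[of _ "\<lambda>x. F x + G x"]) (auto intro!: alg_hull.add simp: frechet_derivative_add diff')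
  next
    case (mult f g)
    then obtain F G where "alg_hull A F" "\<forall>x\<in>S. frechet_derivative f (at x) v = F x"
      "alg_hull A G" "\<forall>x\<in>S. frechet_derivative g (at x) v = G x" by blast
    then show ?case using mult.hyps
      by (intro exI[of _ "\<lambda>x. f x * G x + F x * g x"])
        (auto intro!: alg_hull.add alg_hull.mult simp: frechet_derivative_times diff')
  next
    case (base f)
    then show ?case by (rule deriv)
  qed
qed (use assms in auto)

lemma smooth_up_to_boundary_frechet_derivative:
  assumes "smooth_up_to_boundary S f"
  shows "smooth_up_to_boundary S (\<lambda>x. frechet_derivative f (at x) v)"
proof -
  have "iter_deriv vs (\<lambda>x. frechet_derivative f (at x) v) = iter_deriv (vs @ [v]) f" for vs
    by (simp add: iter_deriv_append)
  then show ?thesis using assms unfolding smooth_up_to_boundary_def smooth_on_def by metis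
qed

lemma smooth_up_to_boundary_differentiable:
  assumes "smooth_up_to_boundary S f" "x \<in> S"
  shows "f differentiable (at x)"
proof -
  have "iter_deriv [] f differentiable (at x)"
    using assms unfolding smooth_up_to_boundary_def smooth_on_def by blast
  then show ?thesis by simp
qed

lemma smooth_up_to_boundary_extension:
  assumes "smooth_up_to_boundary S f"
  obtains F where "continuous_on (closure S) F" "\<And>x. x \<in> S \<Longrightarrow> F x = f x"
proof -
  have "\<exists>F. continuous_on (closure S) F \<and> (\<forall>x\<in>S. F x = iter_deriv [] f x)"
    using assms unfolding smooth_up_to_boundary_def by blast
  then show ?thesis using that by auto
qed

text \<open>With all smooth functions as generators, coinduction up to the algebra operations yields
  closure under sums and products at once.\<close>

lemma smooth_up_to_boundary_hull:
  fixes f :: "'a::real_normed_vector \<Rightarrow> 'b::real_normed_algebra"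
  assumes "open S" "alg_hull (smooth_up_to_boundary S) f"
  shows "smooth_up_to_boundary S f"
proof (rule smooth_up_to_boundary_alg_hull[OF assms])
  show "f differentiable (at x)" if "smooth_up_to_boundary S f" "x \<in> S"
    for f :: "'a \<Rightarrow> 'b" and x
    by (rule smooth_up_to_boundary_differentiable[OF that])
  show "\<exists>F. continuous_on (closure S) F \<and> (\<forall>x\<in>S. F x = f x)" if "smooth_up_to_boundary S f"
    for f :: "'a \<Rightarrow> 'b"
    using smooth_up_to_boundary_extension[OF that] by metis
  show "\<exists>g. alg_hull (smooth_up_to_boundary S) g \<and> (\<forall>x\<in>S. frechet_derivative f (at x) v = g x)"
    if "smooth_up_to_boundary S f" for f :: "'a \<Rightarrow> 'b" and v
    using alg_hull.base[of "smooth_up_to_boundary S", OF smooth_up_to_boundary_frechet_derivative[OF that]]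
    by auto
qed

context
  fixes S :: "'a::real_normed_vector set"
  assumes S: "open S"
begin

lemma smooth_up_to_boundary_const:
  "smooth_up_to_boundary S (\<lambda>_. c :: 'b::real_normed_algebra)"
  by (rule smooth_up_to_boundary_hull[OF S alg_hull.const])

lemma smooth_up_to_boundary_add:
  fixes f g :: "'a \<Rightarrow> 'b::real_normed_algebra"
  shows "smooth_up_to_boundary S f \<Longrightarrow> smooth_up_to_boundary S g \<Longrightarrow>
    smooth_up_to_boundary S (\<lambda>x. f x + g x)"
  by (rule smooth_up_to_boundary_hull[OF S alg_hull.add[OF alg_hull.base alg_hull.base]])

lemma smooth_up_to_boundary_mult:
  fixes f g :: "'a \<Rightarrow> 'b::real_normed_algebra"
  shows "smooth_up_to_boundary S f \<Longrightarrow> smooth_up_to_boundary S g \<Longrightarrow>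
    smooth_up_to_boundary S (\<lambda>x. f x * g x)"
  by (rule smooth_up_to_boundary_hull[OF S alg_hull.mult[OF alg_hull.base alg_hull.base]])

lemma smooth_up_to_boundary_diff:
  fixes f g :: "'a \<Rightarrow> 'b::real_normed_algebra_1"
  assumes "smooth_up_to_boundary S f" "smooth_up_to_boundary S g"
  shows "smooth_up_to_boundary S (\<lambda>x. f x - g x)"
  using smooth_up_to_boundary_add[OF assms(1) smooth_up_to_boundary_mult[OF smooth_up_to_boundary_const[of "-1"] assms(2)]]
  by simp

lemma smooth_up_to_boundary_sum:
  fixes f :: "'i \<Rightarrow> 'a \<Rightarrow> 'b::real_normed_algebra"
  assumes "\<And>i. i \<in> I \<Longrightarrow> smooth_up_to_boundary S (f i)"
  shows "smooth_up_to_boundary S (\<lambda>x. \<Sum>i\<in>I. f i x)"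
  using assms by (induction I rule: infinite_finite_induct)
    (simp_all add: smooth_up_to_boundary_const smooth_up_to_boundary_add)

lemma smooth_up_to_boundary_power:
  fixes f :: "'a \<Rightarrow> 'b::real_normed_algebra_1"
  assumes "smooth_up_to_boundary S f"
  shows "smooth_up_to_boundary S (\<lambda>x. f x ^ m)"
  using assms by (induction m) (simp_all add: smooth_up_to_boundary_const smooth_up_to_boundary_mult)

end

lemma smooth_up_to_boundary_UNIV_inverse:
  fixes u :: "'a::real_normed_vector \<Rightarrow> real"
  assumes u: "smooth_up_to_boundary UNIV u" and nz: "\<And>x. u x \<noteq> 0"
  shows "smooth_up_to_boundary UNIV (\<lambda>x. inverse (u x))"
proof -
  \<comment> \<open>The generators are the smooth functions together with \<open>1/u\<close>; the
    derivative \<open>- (1/u) * u' * (1/u)\<close> is a product of these.\<close>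
  let ?A = "\<lambda>f. smooth_up_to_boundary UNIV f \<or> f = (\<lambda>x. inverse (u x))"
  have D: "((\<lambda>x. inverse (u x)) has_derivative
     (\<lambda>v. - (inverse (u x) * frechet_derivative u (at x) v * inverse (u x)))) (at x)" for x
    using smooth_up_to_boundary_differentiable[OF u]
    by (intro derivative_intros) (auto simp: nz frechet_derivative_works[symmetric])
  show ?thesis
  proof (rule smooth_up_to_boundary_alg_hull[of _ ?A])
    show dif: "f differentiable (at x)" if "?A f" for f x
      using that D smooth_up_to_boundary_differentiable[of UNIV f x] unfolding differentiable_def by auto
    show "\<exists>F. continuous_on (closure UNIV) F \<and> (\<forall>x\<in>UNIV. F x = f x)" if "?A f" for f
      using dif[OF that] by (intro exI[of _ f])
        (auto intro!: continuous_at_imp_continuous_on differentiable_imp_continuous_within)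
    show "\<exists>g. alg_hull ?A g \<and> (\<forall>x\<in>UNIV. frechet_derivative f (at x) v = g x)" if "?A f" for f v
      using that
    proof
      assume "f = (\<lambda>x. inverse (u x))"
      then have "frechet_derivative f (at x) v
          = (-1) * (inverse (u x) * frechet_derivative u (at x) v * inverse (u x))" for x
        using frechet_derivative_at[OF D[of x], THEN fun_cong, of v] by simp
      moreover have "alg_hull ?A (\<lambda>x. (-1) * (inverse (u x) * frechet_derivative u (at x) v * inverse (u x)))"
        by (rule alg_hull.mult[OF alg_hull.const alg_hull.mult[OF alg_hull.mult]])
          (auto intro!: alg_hull.base smooth_up_to_boundary_frechet_derivative[OF u])
      ultimately show ?thesis by blast
    next
      assume "smooth_up_to_boundary UNIV f"
      then have "alg_hull ?A (\<lambda>x. frechet_derivative f (at x) v)"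
        by (intro alg_hull.base disjI1 smooth_up_to_boundary_frechet_derivative)
      then show ?thesis by auto
    qed
  qed (auto intro: alg_hull.base)
qed

section \<open>A smooth step function\<close>

text \<open>The classical flat function \<open>exp (- 1 / t)\<close> with a negative power carried
  along: differentiation creates such powers, and with them the family indexed by \<open>k\<close>
  is closed under differentiation up to linear combinations.\<close>

definition flat_exp :: "nat \<Rightarrow> real \<Rightarrow> real" where
  "flat_exp k t = (if t \<le> 0 then 0 else exp (- 1 / t) / t ^ k)"

lemma flat_exp_tendsto_0: "((\<lambda>t. flat_exp k t) \<longlongrightarrow> 0) (at 0)"
proof (rule filterlim_split_at)
  show "((\<lambda>t. flat_exp k t) \<longlongrightarrow> 0) (at_left 0)"
    by (rule tendsto_eventually) (auto simp: flat_exp_def eventually_at_left_field intro: exI[of _ "-1"])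
  have "((\<lambda>x::real. x ^ k / exp x) \<longlongrightarrow> 0) at_top" by (rule tendsto_power_div_exp_0)
  then have "((\<lambda>t::real. inverse t ^ k / exp (inverse t)) \<longlongrightarrow> 0) (at_right 0)"
    by (rule filterlim_compose) (rule filterlim_inverse_at_top_right)
  moreover have "\<forall>\<^sub>F t in at_right (0::real). inverse t ^ k / exp (inverse t) = flat_exp k t"
    by (auto simp: flat_exp_def eventually_at_right_field exp_minus field_simps intro!: exI[of _ 1])
  ultimately show "((\<lambda>t. flat_exp k t) \<longlongrightarrow> 0) (at_right 0)"
    by (rule Lim_transform_eventually)
qed

lemma flat_exp_has_derivative:
  "(flat_exp k has_real_derivative (flat_exp (k + 2) t - real k * flat_exp (k + 1) t)) (at t)"
proof (cases t "0::real" rule: linorder_cases)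
  case less
  have "((\<lambda>t. 0) has_real_derivative 0) (at t)" by simp
  moreover have "\<forall>\<^sub>F x in nhds t. (0::real) = flat_exp k x"
    using eventually_nhds_in_open[of "{..<0::real}" t] less
    by (auto elim!: eventually_mono simp: flat_exp_def)
  ultimately have "(flat_exp k has_real_derivative 0) (at t)"
    using DERIV_cong_ev[of t t "\<lambda>_. 0" "flat_exp k" 0 0] by simp
  then show ?thesis using less by (simp add: flat_exp_def)
next
  case equal
  \<comment> \<open>Since \<open>flat_exp k 0 = 0\<close>, the difference quotient at 0 is
    \<open>flat_exp (Suc k)\<close> itself.\<close>
  have "((\<lambda>h. (flat_exp k (0 + h) - flat_exp k 0) / h) \<longlongrightarrow> 0) (at 0)"
  proof (rule Lim_transform_eventually[OF flat_exp_tendsto_0[of "Suc k"]])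
    show "\<forall>\<^sub>F h in at 0. flat_exp (Suc k) h = (flat_exp k (0 + h) - flat_exp k 0) / h"
      by (auto simp: flat_exp_def eventually_at_filter)
  qed
  then show ?thesis using equal by (simp add: DERIV_def flat_exp_def)
next
  case greater
  have "((\<lambda>t. exp (- 1 / t) / t ^ k) has_real_derivative
     (flat_exp (k + 2) t - real k * flat_exp (k + 1) t)) (at t)"
    using greater by (auto intro!: derivative_eq_intros simp: flat_exp_def divide_simps)
      (cases k; auto simp: algebra_simps power2_eq_square)
  moreover have "\<forall>\<^sub>F x in nhds t. exp (- 1 / x) / x ^ k = flat_exp k x"
    using eventually_nhds_in_open[of "{0::real<..}" t] greater
    by (auto elim!: eventually_mono simp: flat_exp_def)
  ultimately show ?thesis
    using DERIV_cong_ev[of t t "\<lambda>x. exp (- 1 / x) / x ^ k" "flat_exp k"] by simp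
qed

text \<open>The affine argument is built into the family so that one coinduction covers both
  \<open>t - 1\<close> and \<open>2 - t\<close>, the two arguments in the step function.\<close>

lemma smooth_flat_exp: "smooth_up_to_boundary UNIV (\<lambda>t. flat_exp k (a * t + b))"
proof -
  let ?A = "\<lambda>f. \<exists>k. f = (\<lambda>t. flat_exp k (a * t + b))"
  have D: "((\<lambda>t. flat_exp k (a * t + b)) has_derivative
     (\<lambda>v. v * (a * (flat_exp (k + 2) (a * t + b) - real k * flat_exp (k + 1) (a * t + b))))) (at t)" for k t
  proof -
    have "((\<lambda>t. flat_exp k (a * t + b)) has_real_derivative
       ((flat_exp (k + 2) (a * t + b) - real k * flat_exp (k + 1) (a * t + b)) * a)) (at t)"
      by (rule DERIV_chain2[OF flat_exp_has_derivative]) (auto intro!: derivative_eq_intros)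
    then show ?thesis
      unfolding has_field_derivative_def by (rule has_derivative_eq_rhs) (auto simp: mult_ac)
  qed
  show ?thesis
  proof (rule smooth_up_to_boundary_alg_hull[of _ ?A])
    show dif: "f differentiable (at x)" if "?A f" for f x
      using that D unfolding differentiable_def by auto
    show "\<exists>F. continuous_on (closure UNIV) F \<and> (\<forall>x\<in>UNIV. F x = f x)" if "?A f" for f
      using dif[OF that] by (intro exI[of _ f])
        (auto intro!: continuous_at_imp_continuous_on differentiable_imp_continuous_within)
    show "\<exists>g. alg_hull ?A g \<and> (\<forall>x\<in>UNIV. frechet_derivative f (at x) v = g x)" if "?A f" for f v
    proof -
      obtain k where f: "f = (\<lambda>t. flat_exp k (a * t + b))" using \<open>?A f\<close> by blast
      have "frechet_derivative f (at x) v
          = (v * a) * (flat_exp (k + 2) (a * x + b) + (- real k) * flat_exp (k + 1) (a * x + b))" for x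
        using frechet_derivative_at[OF D[of k x], THEN fun_cong, of v] unfolding f
        by (simp add: algebra_simps)
      moreover have "alg_hull ?A (\<lambda>x. (v * a) * (flat_exp (k + 2) (a * x + b) + (- real k) * flat_exp (k + 1) (a * x + b)))"
        by (rule alg_hull.mult[OF alg_hull.const alg_hull.add[OF _ alg_hull.mult[OF alg_hull.const]]];
            rule alg_hull.base) auto
      ultimately show ?thesis by blast
    qed
  qed (auto intro: alg_hull.base)
qed

text \<open>The denominator never vanishes: \<open>t - 1\<close> and \<open>2 - t\<close> add up to
  1, so at least one of them is positive.\<close>

definition smooth_step :: "real \<Rightarrow> real" where
  "smooth_step t = flat_exp 0 (t - 1) * inverse (flat_exp 0 (t - 1) + flat_exp 0 (2 - t))"

lemma smooth_step_0: "t \<le> 1 \<Longrightarrow> smooth_step t = 0"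
  and smooth_step_1: "t \<ge> 2 \<Longrightarrow> smooth_step t = 1"
  by (auto simp: smooth_step_def flat_exp_def)

lemma smooth_smooth_step: "smooth_up_to_boundary UNIV smooth_step"
proof -
  have 1: "smooth_up_to_boundary UNIV (\<lambda>t. flat_exp 0 (t - 1))"
    using smooth_flat_exp[of 0 1 "-1"] by simp
  have 2: "smooth_up_to_boundary UNIV (\<lambda>t. flat_exp 0 (2 - t))"
    using smooth_flat_exp[of 0 "-1" 2] by (simp add: algebra_simps)
  have pos: "flat_exp 0 (t - 1) + flat_exp 0 (2 - t) \<noteq> 0" for t
    by (auto simp: flat_exp_def add_pos_pos intro!: less_imp_neq[symmetric])
  show ?thesis unfolding smooth_step_def[abs_def]
    by (intro smooth_up_to_boundary_mult smooth_up_to_boundary_UNIV_inverse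
        smooth_up_to_boundary_add 1 2 pos) auto
qed

section \<open>Integration by parts for compact support\<close>

lemma lborel_integral_translate:
  fixes f :: "'a::euclidean_space \<Rightarrow> 'b::{banach, second_countable_topology}"
  assumes [measurable]: "f \<in> borel_measurable borel"
  shows "(LINT x|lborel. f (c + x)) = (LINT x|lborel. f x)"
proof -
  have "(LINT x|lborel. f x) = (LINT x|distr lborel borel ((+) c). f x)"
    by (simp add: lborel_distr_plus)
  also have "\<dots> = (LINT x|lborel. f (c + x))"
    by (rule integral_distr) auto
  finally show ?thesis by simp
qed

lemma lborel_integral_scale:
  fixes f :: "'a::euclidean_space \<Rightarrow> 'b::{banach, second_countable_topology}"
  assumes [measurable]: "f \<in> borel_measurable borel" and "c \<noteq> 0"
  shows "(LINT x|lborel. f x) = \<bar>c\<bar> ^ DIM('a) *\<^sub>R (LINT x|lborel. f (c *\<^sub>R x))"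
proof -
  have "(LINT x|lborel. f x)
      = (LINT x|density (distr lborel borel (\<lambda>x. 0 + c *\<^sub>R x)) (\<lambda>_. \<bar>c\<bar>^DIM('a)). f x)"
    using lborel_affine[OF \<open>c \<noteq> 0\<close>, of "0::'a"] by simp
  also have "\<dots> = (LINT x|distr lborel borel (\<lambda>x. 0 + c *\<^sub>R x). \<bar>c\<bar>^DIM('a) *\<^sub>R f x)"
    by (subst integral_density) auto
  also have "\<dots> = (LINT x|lborel. \<bar>c\<bar>^DIM('a) *\<^sub>R f (0 + c *\<^sub>R x))"
    by (rule integral_distr) auto
  finally show ?thesis by simp
qed

lemma integrable_continuous_support:
  fixes f :: "'a::euclidean_space \<Rightarrow> 'b::{banach, second_countable_topology}"
  assumes "continuous_on UNIV f" "\<And>x. norm x > R \<Longrightarrow> f x = 0"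
  shows "integrable lborel f"
proof -
  have "(\<lambda>x. indicator (cball 0 R) x *\<^sub>R f x) = f"
    using assms(2) by (force simp: indicator_def)
  then show ?thesis
    using borel_integrable_compact[of "cball 0 R" f] assms(1) continuous_on_subset[of UNIV f "cball 0 R"] by simp
qed

text \<open>Passing from a limit over all increments to a single sequence of quotients makes
  measurability and dominated convergence applicable to the derivative.\<close>

lemma frechet_derivative_LIMSEQ:
  fixes F :: "'a::real_normed_vector \<Rightarrow> 'b::real_normed_vector"
  assumes "F differentiable (at x)"
  shows "(\<lambda>n. real (Suc n) *\<^sub>R (F (v /\<^sub>R real (Suc n) + x) - F x)) \<longlonglongrightarrow> frechet_derivative F (at x) v"
proof (cases "v = 0")
  case True
  then show ?thesis using assms by (simp add: linear_frechet_derivative linear_0)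
next
  case False
  let ?D = "frechet_derivative F (at x)" and ?h = "\<lambda>n. v /\<^sub>R real (Suc n)"
  have D: "?D (c *\<^sub>R v) = c *\<^sub>R ?D v" for c
    using assms by (simp add: linear_frechet_derivative linear_cmul)
  have "((\<lambda>h. norm (F (x + h) - F x - ?D h) / norm h) \<longlongrightarrow> 0) (at 0)"
    using assms by (simp add: frechet_derivative_works has_derivative_at)
  moreover have "filterlim ?h (at 0) sequentially"
    unfolding filterlim_at
    using False tendsto_scaleR[OF LIMSEQ_inverse_real_of_nat tendsto_const, of v] by simp
  ultimately have "(\<lambda>n. norm (F (x + ?h n) - F x - ?D (?h n)) / norm (?h n)) \<longlonglongrightarrow> 0"
    by (rule filterlim_compose)
  then have "(\<lambda>n. norm v * (norm (F (x + ?h n) - F x - ?D (?h n)) / norm (?h n))) \<longlonglongrightarrow> 0"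
    by (rule tendsto_mult_right_zero)
  moreover have "norm v * (norm (F (x + ?h n) - F x - ?D (?h n)) / norm (?h n))
      = norm (real (Suc n) *\<^sub>R (F (?h n + x) - F x) - ?D v)" for n
  proof -
    have "real (Suc n) *\<^sub>R (F (?h n + x) - F x) - ?D v = real (Suc n) *\<^sub>R (F (x + ?h n) - F x - ?D (?h n))"
      by (simp add: D scaleR_diff_right add.commute del: of_nat_Suc)
    then have "norm (real (Suc n) *\<^sub>R (F (?h n + x) - F x) - ?D v)
        = real (Suc n) * norm (F (x + ?h n) - F x - ?D (?h n))"
      by (simp del: of_nat_Suc)
    moreover have "norm v / norm (?h n) = real (Suc n)"
      using False by (simp add: field_simps del: of_nat_Suc)
    moreover have "norm v * (norm (F (x + ?h n) - F x - ?D (?h n)) / norm (?h n))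
        = (norm v / norm (?h n)) * norm (F (x + ?h n) - F x - ?D (?h n))"
      by (simp only: times_divide_eq_left times_divide_eq_right)
    ultimately show ?thesis by (simp only:)
  qed
  ultimately have "(\<lambda>n. norm (real (Suc n) *\<^sub>R (F (?h n + x) - F x) - ?D v)) \<longlonglongrightarrow> 0" by simp
  then show ?thesis by (subst (asm) tendsto_norm_zero_iff) (rule LIM_zero_cancel)
qed

lemma norm_difference_quotient_le:
  fixes F :: "'a::real_normed_vector \<Rightarrow> 'b::real_normed_vector"
  assumes "L-lipschitz_on UNIV F"
  shows "norm (real (Suc n) *\<^sub>R (F (v /\<^sub>R real (Suc n) + x) - F x)) \<le> L * norm v"
proof -
  have "norm (F (v /\<^sub>R real (Suc n) + x) - F x) \<le> L * norm (v /\<^sub>R real (Suc n))"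
    using lipschitz_on_normD[OF assms, of "v /\<^sub>R real (Suc n) + x" x] by simp
  then have "real (Suc n) * norm (F (v /\<^sub>R real (Suc n) + x) - F x)
      \<le> real (Suc n) * (L * norm (v /\<^sub>R real (Suc n)))"
    by (intro mult_left_mono) auto
  moreover have "real (Suc n) * (L * norm (v /\<^sub>R real (Suc n))) = L * norm v"
    by (simp del: of_nat_Suc)
  ultimately have "real (Suc n) * norm (F (v /\<^sub>R real (Suc n) + x) - F x) \<le> L * norm v"
    by (rule ord_le_eq_trans)
  then show ?thesis by (simp del: of_nat_Suc)
qed

lemma norm_frechet_derivative_le:
  fixes F :: "'a::real_normed_vector \<Rightarrow> 'b::real_normed_vector"
  assumes "L-lipschitz_on UNIV F" "F differentiable (at x)"
  shows "norm (frechet_derivative F (at x) v) \<le> L * norm v"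
  using tendsto_norm[OF frechet_derivative_LIMSEQ[OF assms(2)]]
  by (rule LIMSEQ_le_const2) (use norm_difference_quotient_le[OF assms(1)] in blast)

lemma frechet_derivative_eq_0_open:
  assumes "open S" "x \<in> S" "\<And>y. y \<in> S \<Longrightarrow> F y = 0"
  shows "frechet_derivative F (at x) v = 0"
  using frechet_derivative_cong_open[OF assms(1,2), of F "\<lambda>_. 0"] assms(3) by simp

lemma open_norm_greater: "open {x :: 'a::real_normed_vector. norm x > R}"
  by (intro open_Collect_less continuous_intros)

lemma frechet_derivative_outside_support:
  assumes "\<And>x. norm x > R \<Longrightarrow> F x = 0" "norm x > R"
  shows "frechet_derivative F (at x) v = 0"
  by (rule frechet_derivative_eq_0_open[OF open_norm_greater[of R]]) (use assms in auto)

lemma borel_measurable_frechet_derivative: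
  fixes F :: "'a::euclidean_space \<Rightarrow> 'b::euclidean_space"
  assumes "\<And>x. F differentiable (at x)"
  shows "(\<lambda>x. frechet_derivative F (at x) v) \<in> borel_measurable borel"
proof (rule borel_measurable_LIMSEQ_metric)
  show "(\<lambda>n. real (Suc n) *\<^sub>R (F (v /\<^sub>R real (Suc n) + x) - F x)) \<longlonglongrightarrow> frechet_derivative F (at x) v" for x
    by (rule frechet_derivative_LIMSEQ[OF assms])
  have "continuous_on UNIV F"
    using assms by (intro continuous_at_imp_continuous_on) (auto intro: differentiable_imp_continuous_within)
  then have [measurable]: "F \<in> borel_measurable borel" by (rule borel_measurable_continuous_onI)
  show "(\<lambda>x. real (Suc n) *\<^sub>R (F (v /\<^sub>R real (Suc n) + x) - F x)) \<in> borel_measurable borel" for n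
    by measurable
qed

text \<open>Each difference quotient has integral zero by translation invariance, and the Lipschitz
  bound lets the quotients converge dominatedly. Because only differentiability and a Lipschitz
  constant are asked for, continuity of the derivative need not be tracked for the products to which
  this is applied.\<close>

lemma
  fixes F :: "'a::euclidean_space \<Rightarrow> 'b::euclidean_space"
  assumes diff: "\<And>x. F differentiable (at x)" and lip: "L-lipschitz_on UNIV F"
    and supp: "\<And>x. norm x > R \<Longrightarrow> F x = 0"
  shows integrable_frechet_derivative: "integrable lborel (\<lambda>x. frechet_derivative F (at x) v)"
    and integral_frechet_derivative_eq_0: "(LINT x|lborel. frechet_derivative F (at x) v) = 0"
proof -
  define s where "s = (\<lambda>n x. real (Suc n) *\<^sub>R (F (v /\<^sub>R real (Suc n) + x) - F x))"
  \<comment> \<open>Translating by at most \<open>v\<close> enlarges the support by at most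
    \<open>norm v\<close>; on the enlarged ball the quotients are bounded by
    \<open>L * norm v\<close>.\<close>
  define w where "w = (\<lambda>x. indicator (cball 0 (R + norm v) :: 'a set) x *\<^sub>R (L * norm v))"
  have contF: "continuous_on UNIV F" by (rule lipschitz_on_continuous_on[OF lip])
  then have [measurable]: "F \<in> borel_measurable borel" by (rule borel_measurable_continuous_onI)
  have intF: "integrable lborel F" by (rule integrable_continuous_support[OF contF supp])
  have intF': "integrable lborel (\<lambda>x. F (c + x))" for c
  proof (rule integrable_continuous_support[of _ "R + norm c"])
    show "continuous_on UNIV (\<lambda>x. F (c + x))"
      by (intro continuous_on_compose2[OF contF] continuous_intros) auto
    show "F (c + x) = 0" if "R + norm c < norm x" for x
      using supp[of "c + x"] that norm_diff_ineq[of x c] by (simp add: add.commute)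
  qed
  have [measurable]: "\<And>n. s n \<in> borel_measurable lborel" unfolding s_def by measurable
  have m: "(\<lambda>x. frechet_derivative F (at x) v) \<in> borel_measurable lborel"
    using borel_measurable_frechet_derivative[OF diff] by simp
  have w: "integrable lborel w" unfolding w_def
    by (rule borel_integrable_compact) auto
  have lim: "AE x in lborel. (\<lambda>n. s n x) \<longlonglongrightarrow> frechet_derivative F (at x) v"
    unfolding s_def using frechet_derivative_LIMSEQ[OF diff] by auto
  have bound: "norm (s n x) \<le> w x" for n x
  proof (cases "norm x \<le> R + norm v")
    case True
    then show ?thesis unfolding s_def w_def
      using norm_difference_quotient_le[OF lip] by (simp add: indicator_def)
  next
    case False
    have "norm (v /\<^sub>R real (Suc n)) \<le> norm v"
      by (simp add: field_simps mult_left_le_one_le mult_le_cancel_right1)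
    then have "norm (v /\<^sub>R real (Suc n) + x) > R"
      using False norm_diff_ineq[of x "v /\<^sub>R real (Suc n)"] by (simp add: add.commute)
    moreover have "norm x > R" using False norm_ge_zero[of v] by linarith
    ultimately show ?thesis using supp False by (simp add: s_def w_def)
  qed
  show "integrable lborel (\<lambda>x. frechet_derivative F (at x) v)"
    by (rule integrable_dominated_convergence[OF m _ w lim]) (use bound in auto)
  have "(\<lambda>n. LINT x|lborel. s n x) \<longlonglongrightarrow> (LINT x|lborel. frechet_derivative F (at x) v)"
    by (rule integral_dominated_convergence[OF m _ w lim]) (use bound in auto)
  moreover have "(LINT x|lborel. s n x) = 0" for n
    using intF intF' lborel_integral_translate[of F] by (simp add: s_def)
  ultimately show "(LINT x|lborel. frechet_derivative F (at x) v) = 0"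
    by (simp add: LIMSEQ_const_iff)
qed

section \<open>Lipschitz bounds from bounded derivatives\<close>

lemma lipschitz_on_UNIV_if_derivative_bounded:
  fixes F :: "'a::real_normed_vector \<Rightarrow> 'b::real_normed_vector"
  assumes "\<And>x. F differentiable (at x)"
    and "\<And>x v. norm (frechet_derivative F (at x) v) \<le> L * norm v" and "0 \<le> L"
  shows "L-lipschitz_on UNIV F"
proof (rule bounded_derivative_imp_lipschitz)
  show "(F has_derivative frechet_derivative F (at x)) (at x within UNIV)" for x
    using assms(1) by (simp add: frechet_derivative_works[symmetric])
  show "onorm (frechet_derivative F (at x)) \<le> L" for x
    by (rule onorm_bound) (use assms in auto)
qed (use assms in auto)

lemma smooth_UNIV_continuous:
  assumes "smooth_up_to_boundary UNIV h"
  shows "continuous_on UNIV h"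
  by (meson assms smooth_up_to_boundary_differentiable continuous_at_imp_continuous_on
      differentiable_imp_continuous_within UNIV_I)

lemma continuous_compact_support_bounded:
  fixes h :: "'a::euclidean_space \<Rightarrow> 'b::real_normed_vector"
  assumes "continuous_on UNIV h" "\<And>x. norm x > R \<Longrightarrow> h x = 0"
  obtains B where "B > 0" "\<And>x. norm (h x) \<le> B"
proof -
  have "bounded (h ` cball 0 R)"
    by (intro compact_imp_bounded compact_continuous_image) (auto intro: continuous_on_subset[OF assms(1)])
  then obtain B where B: "B > 0" "\<And>x. norm x \<le> R \<Longrightarrow> norm (h x) \<le> B"
    by (auto simp: bounded_pos)
  have "norm (h x) \<le> B" for x using B assms(2)[of x] by (cases "norm x \<le> R") auto
  with B that show ?thesis by blast
qed

text \<open>The derivatives along the finitely many basis vectors are continuous with compact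
  support, hence bounded, and by linearity they bound the derivative in every direction.\<close>

lemma smooth_compact_support_lipschitz:
  fixes h :: "'a::euclidean_space \<Rightarrow> 'b::real_normed_vector"
  assumes h: "smooth_up_to_boundary UNIV h" and supp: "\<And>x. norm x > R \<Longrightarrow> h x = 0"
  obtains L where "L-lipschitz_on UNIV h"
proof -
  have dif: "h differentiable (at x)" for x
    using smooth_up_to_boundary_differentiable[OF h] by simp
  have "\<exists>B. \<forall>x. norm (frechet_derivative h (at x) b) \<le> B" for b
  proof (rule continuous_compact_support_bounded)
    show "continuous_on UNIV (\<lambda>x. frechet_derivative h (at x) b)"
      by (intro smooth_UNIV_continuous smooth_up_to_boundary_frechet_derivative h)
    show "frechet_derivative h (at x) b = 0" if "norm x > R" for x
      by (rule frechet_derivative_outside_support[OF supp that])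
  qed blast
  then obtain B where B: "\<And>b x. norm (frechet_derivative h (at x) b) \<le> B b" by metis
  have B0: "B b \<ge> 0" for b using B[of 0 b] norm_ge_zero order_trans by blast
  have "norm (frechet_derivative h (at x) v) \<le> (\<Sum>b\<in>Basis. B b) * norm v" for x v
  proof -
    interpret D: linear "frechet_derivative h (at x)" by (rule linear_frechet_derivative[OF dif])
    have "frechet_derivative h (at x) v = (\<Sum>b\<in>Basis. (v \<bullet> b) *\<^sub>R frechet_derivative h (at x) b)"
      by (subst euclidean_representation[symmetric, of v]) (simp add: D.sum D.scaleR)
    also have "norm \<dots> \<le> (\<Sum>b\<in>Basis. norm v * B b)"
      by (rule sum_norm_le) (auto intro!: mult_mono B Basis_le_norm)
    finally show ?thesis by (simp add: sum_distrib_left mult.commute)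
  qed
  then have "(\<Sum>b\<in>Basis. B b)-lipschitz_on UNIV h"
    by (intro lipschitz_on_UNIV_if_derivative_bounded dif sum_nonneg B0)
  then show ?thesis by (rule that)
qed

text \<open>Between the radii \<open>R / 2 ^ Suc n\<close> and \<open>R / 2 ^ n\<close> the
  integrand is at most \<open>2 ^ Suc n / R\<close>, while the surrounding disc has area of order
  \<open>R\<^sup>2 / 4 ^ n\<close>; the resulting series is geometric with ratio 1/2.\<close>

lemma integrable_inverse_norm_cball:
  "integrable lborel (\<lambda>w::complex. indicator (cball 0 R) w *\<^sub>R inverse (norm w))"
proof (cases "R > 0")
  case False
  then have "w = 0" if "w \<in> cball 0 R" for w :: complex
    using that False norm_le_zero_iff[of w] order_trans[of "norm w" R 0] by simp
  then have "(\<lambda>w::complex. indicator (cball 0 R) w *\<^sub>R inverse (norm w)) = (\<lambda>_. 0)"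
    by (force simp: indicator_def)
  then show ?thesis by simp
next
  case R: True
  have pw: "ennreal (norm (indicator (cball (0::complex) R) w *\<^sub>R inverse (norm w)))
      \<le> (\<Sum>n. ennreal (2 ^ Suc n / R) * indicator (cball 0 (R / 2 ^ n)) w)" (is "_ \<le> suminf ?f")
    for w :: complex
  proof (cases "w \<noteq> 0 \<and> norm w \<le> R")
    case True
    then have "\<exists>n. R / 2 ^ n < norm w"
    proof -
      have "\<exists>n. inverse 2 ^ n < norm w / R"
        using True R real_arch_pow_inv[of "norm w / R" "inverse 2"] by simp
      then show ?thesis using R by (auto simp: field_simps)
    qed
    then obtain n where n: "\<not> R / 2 ^ n < norm w" "R / 2 ^ Suc n < norm w"
      using ex_least_nat_less[of "\<lambda>n. R / 2 ^ n < norm w"] True by auto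
    have "ennreal (norm (indicator (cball (0::complex) R) w *\<^sub>R inverse (norm w))) \<le> ?f n"
    proof -
      have "inverse (norm w) \<le> inverse (R / 2 ^ Suc n)"
        using n R by (intro le_imp_inverse_le) auto
      then show ?thesis using n True by (auto simp: indicator_def intro!: ennreal_leI)
    qed
    also have "\<dots> \<le> suminf ?f" using sum_le_suminf[of ?f "{n}"] by (simp del: sum_mult_indicator)
    finally show ?thesis .
  qed (auto simp: indicator_def)
  have sums: "(\<lambda>n. 2 * R * unit_ball_vol 2 * (1/2) ^ n) sums (2 * R * unit_ball_vol 2 * (1 / (1 - 1/2)))"
    by (intro sums_mult geometric_sums) auto
  have "(\<integral>\<^sup>+w. ennreal (norm (indicator (cball (0::complex) R) w *\<^sub>R inverse (norm w))) \<partial>lborel)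
      \<le> (\<integral>\<^sup>+w. (\<Sum>n. ennreal (2 ^ Suc n / R) * indicator (cball (0::complex) (R / 2 ^ n)) w) \<partial>lborel)"
    by (intro nn_integral_mono pw)
  also have "\<dots> = (\<Sum>n. \<integral>\<^sup>+w. ennreal (2 ^ Suc n / R) * indicator (cball (0::complex) (R / 2 ^ n)) w \<partial>lborel)"
    by (rule nn_integral_suminf)
      (auto intro!: borel_measurable_times_ennreal borel_measurable_indicator borel_closed)
  also have "\<dots> = (\<Sum>n. ennreal (2 * R * unit_ball_vol 2 * (1/2) ^ n))"
  proof (intro suminf_cong)
    fix n
    have "(\<integral>\<^sup>+w. ennreal (2 ^ Suc n / R) * indicator (cball (0::complex) (R / 2 ^ n)) w \<partial>lborel)
       = ennreal (2 ^ Suc n / R) * ennreal (unit_ball_vol 2 * (R / 2 ^ n) ^ 2)"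
      using R by (subst nn_integral_cmult_indicator) (auto simp: emeasure_cball)
    also have "\<dots> = ennreal (2 ^ Suc n / R * (unit_ball_vol 2 * (R / 2 ^ n) ^ 2))"
      using R by (subst ennreal_mult) auto
    also have "2 ^ Suc n / R * (unit_ball_vol 2 * (R / 2 ^ n) ^ 2) = 2 * R * unit_ball_vol 2 * (1/2) ^ n"
      using R by (simp add: power2_eq_square field_simps)
    finally show "(\<integral>\<^sup>+w. ennreal (2 ^ Suc n / R) * indicator (cball (0::complex) (R / 2 ^ n)) w \<partial>lborel)
       = ennreal (2 * R * unit_ball_vol 2 * (1/2) ^ n)" .
  qed
  also have "\<dots> = ennreal (2 * R * unit_ball_vol 2 * (1 / (1 - 1/2)))"
    by (rule suminf_ennreal_eq[OF _ sums]) (use R in auto)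
  also have "\<dots> < \<infinity>" by simp
  finally show ?thesis
    by (intro integrableI_bounded)
      (auto intro!: borel_measurable_times borel_measurable_indicator borel_closed)
qed

section \<open>The Cauchy--Pompeiu formula\<close>

text \<open>For \<open>v = \<i> u\<close> this is the Wirtinger derivative in the conjugate variable
  along the complex direction \<open>u\<close>. Passing \<open>v\<close> separately lets the
  operator act on real spaces without complex scalars, such as the domain of
  \<open>cauchy_transform\<close>.\<close>

definition dbar :: "'a \<Rightarrow> 'a \<Rightarrow> ('a::real_normed_vector \<Rightarrow> complex) \<Rightarrow> 'a \<Rightarrow> complex" where
  "dbar u v f x = (frechet_derivative f (at x) u + \<i> * frechet_derivative f (at x) v) / 2"

lemma dbar_eqI:
  assumes "(f has_derivative D) (at x)"
  shows "dbar u v f x = (D u + \<i> * D v) / 2"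
  using frechet_derivative_at[OF assms] by (simp add: dbar_def)

lemma dbar_mult:
  assumes "f differentiable (at x)" "g differentiable (at x)"
  shows "dbar u v (\<lambda>x. f x * g x) x = f x * dbar u v g x + dbar u v f x * g x"
  using assms by (simp add: dbar_def frechet_derivative_times field_simps)

lemma dbar_cong_open:
  assumes "open S" "x \<in> S" "\<And>y. y \<in> S \<Longrightarrow> f y = g y"
  shows "dbar u v f x = dbar u v g x"
  using frechet_derivative_cong_open[OF assms] by (simp add: dbar_def)

lemma dbar_const [simp]: "dbar u v (\<lambda>_. c) x = 0"
  by (simp add: dbar_def)

lemma smooth_dbar:
  assumes "open S" "smooth_up_to_boundary S f"
  shows "smooth_up_to_boundary S (dbar u v f)"
proof -
  have "smooth_up_to_boundary S (\<lambda>x. (1/2) * (frechet_derivative f (at x) u + \<i> * frechet_derivative f (at x) v))"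
    by (intro smooth_up_to_boundary_mult smooth_up_to_boundary_add smooth_up_to_boundary_const
        smooth_up_to_boundary_frechet_derivative assms)
  then show ?thesis by (simp add: dbar_def[abs_def])
qed

lemma
  fixes F :: "'a::euclidean_space \<Rightarrow> complex"
  assumes "\<And>x. F differentiable (at x)" "L-lipschitz_on UNIV F" "\<And>x. norm x > R \<Longrightarrow> F x = 0"
  shows integrable_dbar: "integrable lborel (dbar u v F)"
    and integral_dbar_eq_0: "(LINT x|lborel. dbar u v F x) = 0"
  unfolding dbar_def[abs_def]
  using integrable_frechet_derivative[OF assms] integral_frechet_derivative_eq_0[OF assms]
  by simp_all

lemma borel_measurable_dbar:
  fixes F :: "'a::euclidean_space \<Rightarrow> complex"
  assumes "\<And>x. F differentiable (at x)"
  shows "dbar u v F \<in> borel_measurable borel"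
  unfolding dbar_def[abs_def] using borel_measurable_frechet_derivative[OF assms, measurable (raw)]
  by measurable

lemma dbar_outside_support:
  assumes "\<And>x. norm x > R \<Longrightarrow> F x = 0" "norm x > R"
  shows "dbar u v F x = 0"
  using frechet_derivative_outside_support[OF assms] by (simp add: dbar_def)

text \<open>\<open>reg_kernel\<close> is a \<open>C\<^sup>1\<close> modification of \<open>1/w = cnj w / |w|\<^sup>2\<close>: \<open>1/t\<close> is continued below \<open>t = 1\<close> by
  its tangent line.\<close>

definition reg_inverse :: "real \<Rightarrow> real" where
  "reg_inverse t = (if t \<le> 1 then 2 - t else 1 / t)"

definition reg_inverse' :: "real \<Rightarrow> real" where
  "reg_inverse' t = (if t \<le> 1 then - 1 else - 1 / t ^ 2)"

lemma reg_inverse_has_derivative: "(reg_inverse has_real_derivative reg_inverse' t) (at t)"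
proof (cases t "1::real" rule: linorder_cases)
  case less
  have "((\<lambda>t. 2 - t) has_real_derivative reg_inverse' t) (at t)"
    using less by (auto intro!: derivative_eq_intros simp: reg_inverse'_def)
  moreover have "\<forall>\<^sub>F x in nhds t. 2 - x = reg_inverse x"
    using eventually_nhds_in_open[of "{..<1::real}" t] less
    by (auto elim!: eventually_mono simp: reg_inverse_def)
  ultimately show ?thesis using DERIV_cong_ev[of t t "\<lambda>t. 2 - t" reg_inverse] by simp
next
  case equal
  have "((\<lambda>h. (reg_inverse (1 + h) - reg_inverse 1) / h) \<longlongrightarrow> - 1) (at 0)"
  proof (rule filterlim_split_at)
    show "((\<lambda>h. (reg_inverse (1 + h) - reg_inverse 1) / h) \<longlongrightarrow> - 1) (at_left 0)"
      by (rule tendsto_eventually)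
        (auto simp: reg_inverse_def eventually_at_left_field intro!: exI[of _ "-1"])
    have "((\<lambda>h::real. - 1 / (1 + h)) \<longlongrightarrow> - 1 / (1 + 0)) (at_right 0)"
      by (intro tendsto_intros) auto
    moreover have "\<forall>\<^sub>F h in at_right 0. - 1 / (1 + h) = (reg_inverse (1 + h) - reg_inverse 1) / h"
      by (auto simp: reg_inverse_def eventually_at_right_field divide_simps intro!: exI[of _ 1])
    ultimately show "((\<lambda>h. (reg_inverse (1 + h) - reg_inverse 1) / h) \<longlongrightarrow> - 1) (at_right 0)"
      using Lim_transform_eventually by fastforce
  qed
  then show ?thesis using equal by (simp add: DERIV_def reg_inverse'_def)
next
  case greater
  have "((\<lambda>t. 1 / t) has_real_derivative reg_inverse' t) (at t)"
    using greater by (auto intro!: derivative_eq_intros simp: reg_inverse'_def power2_eq_square)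
  moreover have "\<forall>\<^sub>F x in nhds t. 1 / x = reg_inverse x"
    using eventually_nhds_in_open[of "{1::real<..}" t] greater
    by (auto elim!: eventually_mono simp: reg_inverse_def)
  ultimately show ?thesis using DERIV_cong_ev[of t t "\<lambda>t. 1 / t" reg_inverse] by simp
qed

definition reg_kernel :: "complex \<Rightarrow> complex" where
  "reg_kernel w = cnj w * of_real (reg_inverse (w \<bullet> w))"

definition reg_kernel' :: "complex \<Rightarrow> complex \<Rightarrow> complex" where
  "reg_kernel' w v = cnj v * of_real (reg_inverse (w \<bullet> w))
     + cnj w * of_real (reg_inverse' (w \<bullet> w) * (2 * (w \<bullet> v)))"

lemma reg_kernel_has_derivative: "(reg_kernel has_derivative reg_kernel' w) (at w)"
proof -
  have "((\<lambda>w. reg_inverse (w \<bullet> w)) has_derivative (\<lambda>v. reg_inverse' (w \<bullet> w) * (2 * (w \<bullet> v)))) (at w)"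
    by (rule has_derivative_eq_rhs[OF has_derivative_compose[where g = reg_inverse, OF _
          reg_inverse_has_derivative[unfolded has_field_derivative_def]]])
      (auto intro!: derivative_eq_intros simp: inner_commute)
  then have "((\<lambda>w. complex_of_real (reg_inverse (w \<bullet> w))) has_derivative
      (\<lambda>v. of_real (reg_inverse' (w \<bullet> w) * (2 * (w \<bullet> v))))) (at w)"
    by (rule has_derivative_of_real)
  then show ?thesis
    unfolding reg_kernel_def[abs_def] reg_kernel'_def[abs_def]
    by (rule has_derivative_eq_rhs[OF has_derivative_mult[OF
          bounded_linear_imp_has_derivative[OF bounded_linear_cnj]]]) (auto simp: add.commute)
qed

text \<open>For \<open>cnj w * \<rho> (|w|\<^sup>2)\<close> the Cauchy-Riemann derivative is the
  derivative of \<open>t * \<rho> t\<close> at \<open>t = |w|\<^sup>2\<close>. It vanishes where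
  \<open>\<rho> t = 1 / t\<close>, and the tangent line contributes \<open>2 - 2 * t\<close>, so a
  bump on the unit disc takes the place of a point mass.\<close>

lemma dbar_reg_kernel:
  "dbar 1 \<i> reg_kernel w = of_real (2 * max 0 (1 - w \<bullet> w))"
proof -
  have "dbar 1 \<i> reg_kernel w = of_real (reg_inverse (w \<bullet> w) + (w \<bullet> w) * reg_inverse' (w \<bullet> w))"
    unfolding dbar_eqI[OF reg_kernel_has_derivative]
    by (simp add: reg_kernel'_def complex_eq_iff inner_complex_def algebra_simps)
  also have "reg_inverse (w \<bullet> w) + (w \<bullet> w) * reg_inverse' (w \<bullet> w) = 2 * max 0 (1 - w \<bullet> w)"
    by (auto simp: reg_inverse_def reg_inverse'_def power2_eq_square)
  finally show ?thesis .
qed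

lemma reg_kernel_eq_inverse: "norm w > 1 \<Longrightarrow> reg_kernel w = inverse w"
proof -
  assume "norm w > 1"
  then have "w \<bullet> w > 1" by (simp add: dot_square_norm one_less_power)
  moreover have "cnj w * w = of_real (w \<bullet> w)"
    by (simp add: complex_eq_iff inner_complex_def)
  moreover have "w \<noteq> 0" using \<open>norm w > 1\<close> by auto
  ultimately have "cnj w = inverse w * of_real (w \<bullet> w)"
    by (simp add: eq_divide_eq inverse_eq_divide)
  then have "cnj w / of_real (w \<bullet> w) = inverse w"
    using \<open>w \<bullet> w > 1\<close> nonzero_divide_eq_eq[of "of_real (w \<bullet> w)" "cnj w" "inverse w"] by simp
  with \<open>w \<bullet> w > 1\<close> show ?thesis by (simp add: reg_kernel_def reg_inverse_def)
qed

lemma reg_inverse_nonneg: "reg_inverse t \<ge> 0"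
  by (simp add: reg_inverse_def)

lemma norm_reg_kernel: "norm (reg_kernel w) = norm w * reg_inverse ((norm w)\<^sup>2)"
  by (simp add: reg_kernel_def norm_mult dot_square_norm reg_inverse_nonneg)

text \<open>The tangent line of the convex function \<open>1 / t\<close> lies below it:
  \<open>t * (2 - t) \<le> 1\<close>. The bound survives replacing \<open>w\<close> by
  \<open>w / \<epsilon>\<close> and dividing by \<open>\<epsilon>\<close>, which gives one
  integrable majorant for all scales.\<close>

lemma norm_reg_kernel_le: "norm (reg_kernel w) \<le> inverse (norm w)"
proof (cases "w = 0")
  case False
  have "0 \<le> ((norm w)\<^sup>2 - 1)\<^sup>2" by simp
  then have "(norm w)\<^sup>2 * (2 - (norm w)\<^sup>2) \<le> 1" by (simp add: power2_eq_square algebra_simps)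
  then have "(norm w)\<^sup>2 * reg_inverse ((norm w)\<^sup>2) \<le> 1" by (auto simp: reg_inverse_def)
  then show ?thesis using False unfolding norm_reg_kernel
    by (simp add: field_simps power2_eq_square)
qed (simp add: reg_kernel_def)

lemma norm_reg_kernel_le_2: "norm (reg_kernel w) \<le> 2"
proof (cases "norm w \<le> 1")
  case True
  then have "norm w * (2 - (norm w)\<^sup>2) \<le> 1 * 2"
    by (intro mult_mono) (use power_le_one[of "norm w" 2] in auto)
  moreover have "(norm w)\<^sup>2 \<le> 1" using True by (simp add: power_le_one)
  ultimately show ?thesis by (simp add: norm_reg_kernel reg_inverse_def)
next
  case False
  then have "inverse (norm w) \<le> 1" by (simp add: inverse_le_1_iff)
  then show ?thesis using norm_reg_kernel_le[of w] by linarith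
qed

text \<open>Together with \<open>norm_reg_kernel_le_2\<close> this makes the product of the kernel
  with a bounded Lipschitz function Lipschitz again, as integration by parts requires.\<close>

lemma norm_reg_kernel'_le: "norm (reg_kernel' w v) \<le> 4 * norm v"
proof -
  have "\<bar>reg_inverse (w \<bullet> w)\<bar> \<le> 2"
    using inner_ge_zero[of w] by (auto simp: reg_inverse_def divide_le_eq simp del: inner_ge_zero)
  then have 1: "norm v * \<bar>reg_inverse (w \<bullet> w)\<bar> \<le> norm v * 2" by (intro mult_left_mono) auto
  have reg_inverse': "t * \<bar>reg_inverse' t\<bar> \<le> 1" if "t \<ge> 0" for t
    using that by (auto simp: reg_inverse'_def power2_eq_square)
  have "(norm w)\<^sup>2 * \<bar>reg_inverse' ((norm w)\<^sup>2)\<bar> \<le> 1"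
    using reg_inverse'[of "(norm w)\<^sup>2"] by simp
  then have 3: "2 * norm v * ((norm w)\<^sup>2 * \<bar>reg_inverse' ((norm w)\<^sup>2)\<bar>) \<le> 2 * norm v * 1"
    by (intro mult_left_mono) auto
  have "norm w * (\<bar>reg_inverse' (w \<bullet> w)\<bar> * (2 * \<bar>w \<bullet> v\<bar>)) \<le> norm w * (\<bar>reg_inverse' (w \<bullet> w)\<bar> * (2 * (norm w * norm v)))"
    by (intro mult_left_mono Cauchy_Schwarz_ineq2) auto
  also have "\<dots> \<le> 2 * norm v" using 3 by (simp add: dot_square_norm power2_eq_square mult_ac)
  finally have 2: "norm w * (\<bar>reg_inverse' (w \<bullet> w)\<bar> * (2 * \<bar>w \<bullet> v\<bar>)) \<le> 2 * norm v" .
  have "norm (reg_kernel' w v) \<le> norm v * \<bar>reg_inverse (w \<bullet> w)\<bar>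
      + norm w * (\<bar>reg_inverse' (w \<bullet> w)\<bar> * (2 * \<bar>w \<bullet> v\<bar>))"
    unfolding reg_kernel'_def by (rule order_trans[OF norm_triangle_ineq]) (simp add: norm_mult abs_mult)
  with 1 2 show ?thesis by linarith
qed

text \<open>This is \<open>dbar 1 \<i> reg_kernel\<close> as a real function. Its integral equals
  pi, the constant of the Cauchy-Pompeiu formula; it is carried along unevaluated and finally
  divided out.\<close>

definition bump :: "complex \<Rightarrow> real" where
  "bump w = 2 * max 0 (1 - w \<bullet> w)"

lemma continuous_on_bump: "continuous_on UNIV bump"
  unfolding bump_def[abs_def] by (intro continuous_intros)

lemma bump_outside: "norm w > 1 \<Longrightarrow> bump w = 0"
  by (simp add: bump_def dot_square_norm)

lemma integrable_bump: "integrable lborel bump"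
  by (rule integrable_continuous_support[OF continuous_on_bump bump_outside])

lemma integral_bump_pos: "(LINT w|lborel. bump w) > 0"
proof -
  \<comment> \<open>On this disc \<open>bump\<close> is at least \<open>2 * (1 - 1/4)\<close>, hence
    at least 1.\<close>
  let ?B = "cball (0::complex) (1/2)"
  have "0 < measure lborel ?B"
    by (simp add: content_cball)
  also have "\<dots> = (LINT w|lborel. indicator ?B w)" by simp
  also have "\<dots> \<le> (LINT w|lborel. bump w)"
  proof (rule integral_mono)
    show "integrable lborel (indicat_real ?B)"
      using borel_integrable_compact[of ?B "\<lambda>_. 1::real"] by simp
    show "indicat_real ?B w \<le> bump w" for w
    proof -
      have "w \<bullet> w \<le> (1/2)\<^sup>2" if "norm w \<le> 1/2" 
        unfolding dot_square_norm by (rule power_mono[OF that]) simp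
      then show ?thesis by (auto simp: bump_def indicator_def power2_eq_square)
    qed
  qed (rule integrable_bump)
  finally show ?thesis .
qed

text \<open>After rescaling, \<open>F (\<epsilon> w)\<close> times the kernel is Lipschitz with
  compact support, so its Cauchy-Riemann derivative integrates to zero; the product rule splits that
  integral into the two sides.\<close>

lemma integral_dbar_scaled_kernel:
  fixes F :: "complex \<Rightarrow> complex"
  assumes diff: "\<And>x. F differentiable (at x)" and lip: "L-lipschitz_on UNIV F"
    and supp: "\<And>x. norm x > R \<Longrightarrow> F x = 0" and e: "\<epsilon> > 0"
  shows "(LINT w|lborel. dbar 1 \<i> F w * (reg_kernel (w /\<^sub>R \<epsilon>) /\<^sub>R \<epsilon>)) = - (LINT w|lborel. F (\<epsilon> *\<^sub>R w) * bump w)"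
proof -
  have contF: "continuous_on UNIV F" by (rule lipschitz_on_continuous_on[OF lip])
  obtain M where M: "M > 0" "\<And>x. norm (F x) \<le> M"
    using continuous_compact_support_bounded[OF contF supp] by blast
  have L: "L \<ge> 0" using lip by (rule lipschitz_on_nonneg)
  define G where "G = (\<lambda>w. F (\<epsilon> *\<^sub>R w) * reg_kernel w)"
  have DF: "((\<lambda>w. F (\<epsilon> *\<^sub>R w)) has_derivative (\<lambda>v. \<epsilon> *\<^sub>R frechet_derivative F (at (\<epsilon> *\<^sub>R w)) v)) (at w)" for w
  proof -
    have "((\<lambda>w. F (\<epsilon> *\<^sub>R w)) has_derivative (\<lambda>v. frechet_derivative F (at (\<epsilon> *\<^sub>R w)) (\<epsilon> *\<^sub>R v))) (at w)"
      by (rule has_derivative_compose[where g = F])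
        (use diff in \<open>auto intro!: derivative_eq_intros simp: frechet_derivative_works[symmetric]\<close>)
    then show ?thesis
      using linear_cmul[OF linear_frechet_derivative[OF diff]] by simp
  qed
  have DG: "(G has_derivative (\<lambda>v. F (\<epsilon> *\<^sub>R w) * reg_kernel' w v
      + \<epsilon> *\<^sub>R frechet_derivative F (at (\<epsilon> *\<^sub>R w)) v * reg_kernel w)) (at w)" for w
    unfolding G_def by (rule has_derivative_mult[OF DF reg_kernel_has_derivative])
  have dG: "G differentiable (at w)" for w using DG unfolding differentiable_def by blast
  have "(M * 4 + \<epsilon> * L * 2)-lipschitz_on UNIV G"
  proof (rule lipschitz_on_UNIV_if_derivative_bounded[OF dG])
    show "0 \<le> M * 4 + \<epsilon> * L * 2" using M L e by simp
    fix w v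
    have "norm (frechet_derivative G (at w) v)
        = norm (F (\<epsilon> *\<^sub>R w) * reg_kernel' w v + \<epsilon> *\<^sub>R frechet_derivative F (at (\<epsilon> *\<^sub>R w)) v * reg_kernel w)"
      using frechet_derivative_at[OF DG[of w]] by metis
    also have "\<dots> \<le> norm (F (\<epsilon> *\<^sub>R w)) * norm (reg_kernel' w v)
        + \<epsilon> * norm (frechet_derivative F (at (\<epsilon> *\<^sub>R w)) v) * norm (reg_kernel w)"
      using e by (intro order_trans[OF norm_triangle_ineq]) (simp add: norm_mult)
    also have "\<dots> \<le> M * (4 * norm v) + \<epsilon> * (L * norm v) * 2"
      using e M L norm_reg_kernel_le_2 norm_reg_kernel'_le norm_frechet_derivative_le[OF lip diff]
      by (intro add_mono mult_mono) auto
    finally show "norm (frechet_derivative G (at w) v) \<le> (M * 4 + \<epsilon> * L * 2) * norm v"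
      by (simp add: algebra_simps)
  qed
  moreover have suppG: "G w = 0" if "norm w > R / \<epsilon>" for w
    using supp[of "\<epsilon> *\<^sub>R w"] that e by (simp add: G_def field_simps)
  ultimately have int: "integrable lborel (dbar 1 \<i> G)" and "(LINT w|lborel. dbar 1 \<i> G w) = 0"
    using integrable_dbar[OF dG] integral_dbar_eq_0[OF dG] by blast+
  have dbarG: "dbar 1 \<i> G w = \<epsilon> *\<^sub>R dbar 1 \<i> F (\<epsilon> *\<^sub>R w) * reg_kernel w + F (\<epsilon> *\<^sub>R w) * bump w" for w
  proof -
    have "dbar 1 \<i> G w = F (\<epsilon> *\<^sub>R w) * dbar 1 \<i> reg_kernel w + dbar 1 \<i> (\<lambda>w. F (\<epsilon> *\<^sub>R w)) w * reg_kernel w"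
      unfolding G_def using DF reg_kernel_has_derivative
      by (intro dbar_mult) (auto simp: differentiable_def)
    then show ?thesis unfolding dbar_reg_kernel bump_def dbar_eqI[OF DF]
      by (simp add: dbar_def scaleR_conv_of_real algebra_simps)
  qed
  have "continuous_on UNIV (\<lambda>w. F (\<epsilon> *\<^sub>R w) * of_real (bump w))"
    by (intro continuous_intros continuous_on_compose2[OF contF] continuous_on_bump) auto
  then have int2: "integrable lborel (\<lambda>w. F (\<epsilon> *\<^sub>R w) * of_real (bump w))"
    by (rule integrable_continuous_support[of _ 1]) (simp add: bump_outside)
  have [measurable]: "dbar 1 \<i> F \<in> borel_measurable borel" by (rule borel_measurable_dbar[OF diff])
  have "continuous_on UNIV reg_kernel"
    by (intro continuous_at_imp_continuous_on ballI has_derivative_continuous[OF reg_kernel_has_derivative])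
  then have [measurable]: "reg_kernel \<in> borel_measurable borel" by (rule borel_measurable_continuous_onI)
  have "(LINT w|lborel. dbar 1 \<i> F w * (reg_kernel (w /\<^sub>R \<epsilon>) /\<^sub>R \<epsilon>))
      = \<bar>\<epsilon>\<bar> ^ DIM(complex) *\<^sub>R (LINT w|lborel. dbar 1 \<i> F (\<epsilon> *\<^sub>R w) * (reg_kernel ((\<epsilon> *\<^sub>R w) /\<^sub>R \<epsilon>) /\<^sub>R \<epsilon>))"
    by (rule lborel_integral_scale) (use e in auto)
  also have "\<dots> = (LINT w|lborel. \<epsilon>\<^sup>2 *\<^sub>R (dbar 1 \<i> F (\<epsilon> *\<^sub>R w) * (reg_kernel ((\<epsilon> *\<^sub>R w) /\<^sub>R \<epsilon>) /\<^sub>R \<epsilon>)))"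
    using e by simp
  \<comment> \<open>The Jacobian \<open>\<epsilon>\<^sup>2\<close> and the factor
    \<open>1 / \<epsilon>\<close> of the kernel leave exactly the \<open>\<epsilon>\<close> that the
    chain rule puts into \<open>dbar 1 \<i> G\<close>.\<close>
  also have "\<dots> = (LINT w|lborel. dbar 1 \<i> G w - F (\<epsilon> *\<^sub>R w) * bump w)"
    using e by (intro Bochner_Integration.integral_cong) (auto simp: dbarG power2_eq_square)
  also have "\<dots> = - (LINT w|lborel. F (\<epsilon> *\<^sub>R w) * bump w)"
    using int int2 \<open>(LINT w|lborel. dbar 1 \<i> G w) = 0\<close> by simp
  finally show ?thesis .
qed

text \<open>As the scale tends to 0, the kernels tend to \<open>inverse w\<close> under the majorant
  \<open>1 / |w|\<close>, while the rescaled values of \<open>F\<close> under the bump concentrate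
  at \<open>F 0\<close>.\<close>

lemma integral_dbar_inverse:
  fixes F :: "complex \<Rightarrow> complex"
  assumes diff: "\<And>x. F differentiable (at x)" and lip: "L-lipschitz_on UNIV F"
    and supp: "\<And>x. norm x > R \<Longrightarrow> F x = 0"
  shows "(LINT w|lborel. dbar 1 \<i> F w * inverse w) = - F 0 * (LINT w|lborel. bump w)"
proof -
  have contF: "continuous_on UNIV F" by (rule lipschitz_on_continuous_on[OF lip])
  obtain M where M: "M > 0" "\<And>x. norm (F x) \<le> M"
    using continuous_compact_support_bounded[OF contF supp] by blast
  have L: "L \<ge> 0" using lip by (rule lipschitz_on_nonneg)
  have [measurable]: "dbar 1 \<i> F \<in> borel_measurable borel" by (rule borel_measurable_dbar[OF diff])
  have [measurable]: "F \<in> borel_measurable borel" by (rule borel_measurable_continuous_onI[OF contF])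
  have [measurable]: "bump \<in> borel_measurable borel" by (rule borel_measurable_continuous_onI[OF continuous_on_bump])
  have "continuous_on UNIV reg_kernel"
    by (intro continuous_at_imp_continuous_on ballI has_derivative_continuous[OF reg_kernel_has_derivative])
  then have [measurable]: "reg_kernel \<in> borel_measurable borel" by (rule borel_measurable_continuous_onI)
  have bd: "norm (dbar 1 \<i> F w) \<le> L" for w
  proof -
    have "norm (dbar 1 \<i> F w) \<le> (norm (frechet_derivative F (at w) 1) + norm (frechet_derivative F (at w) \<i>)) / 2"
      unfolding dbar_def norm_divide by (rule order_trans[OF divide_right_mono[OF norm_triangle_ineq]]) (auto simp: norm_mult)
    then show ?thesis
      using norm_frechet_derivative_le[OF lip diff, of w 1] norm_frechet_derivative_le[OF lip diff, of w \<i>] by simp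
  qed
  define e where "e = (\<lambda>n. inverse (real (Suc n)))"
  have e: "e n > 0" "e n \<le> 1" for n by (auto simp: e_def field_simps)
  have e0: "e \<longlonglongrightarrow> 0" unfolding e_def by (rule LIMSEQ_inverse_real_of_nat)
  have lim1: "(\<lambda>n. LINT w|lborel. dbar 1 \<i> F w * (reg_kernel (w /\<^sub>R e n) /\<^sub>R e n))
      \<longlonglongrightarrow> (LINT w|lborel. dbar 1 \<i> F w * inverse w)"
  proof (rule integral_dominated_convergence[where w = "\<lambda>w. L * (indicator (cball 0 R) w *\<^sub>R inverse (norm w))"])
    show "integrable lborel (\<lambda>w::complex. L * (indicator (cball 0 R) w *\<^sub>R inverse (norm w)))"
      by (intro integrable_mult_right integrable_inverse_norm_cball)
    show "AE w in lborel. norm (dbar 1 \<i> F w * (reg_kernel (w /\<^sub>R e n) /\<^sub>R e n))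
        \<le> L * (indicator (cball 0 R) w *\<^sub>R inverse (norm w))" for n
    proof (intro AE_I2)
      fix w :: complex
      have "norm (reg_kernel (w /\<^sub>R e n) /\<^sub>R e n) \<le> inverse (norm w)"
        using norm_reg_kernel_le[of "w /\<^sub>R e n"] e[of n] by (simp add: field_simps)
      then have "norm (dbar 1 \<i> F w * (reg_kernel (w /\<^sub>R e n) /\<^sub>R e n)) \<le> L * inverse (norm w)"
        unfolding norm_mult using bd[of w] L by (intro mult_mono) auto
      moreover have "dbar 1 \<i> F w = 0" if "w \<notin> cball 0 R"
        by (rule dbar_outside_support[where R = R, OF supp]) (use that in auto)
      ultimately show "norm (dbar 1 \<i> F w * (reg_kernel (w /\<^sub>R e n) /\<^sub>R e n))
        \<le> L * (indicator (cball 0 R) w *\<^sub>R inverse (norm w))"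
        by (cases "w \<in> cball 0 R") auto
    qed
    show "AE w in lborel. (\<lambda>n. dbar 1 \<i> F w * (reg_kernel (w /\<^sub>R e n) /\<^sub>R e n)) \<longlonglongrightarrow> dbar 1 \<i> F w * inverse w"
    proof (intro AE_I2 tendsto_mult tendsto_const)
      fix w :: complex
      \<comment> \<open>At \<open>w = 0\<close> all terms and the limit are 0 because
        \<open>inverse 0 = 0\<close>; elsewhere the sequence is eventually constant.\<close>
      show "(\<lambda>n. reg_kernel (w /\<^sub>R e n) /\<^sub>R e n) \<longlonglongrightarrow> inverse w"
      proof (cases "w = 0")
        case False
        then have "\<forall>\<^sub>F n in sequentially. e n < norm w"
          using order_tendstoD(2)[OF e0, of "norm w"] by simp
        then have "\<forall>\<^sub>F n in sequentially. reg_kernel (w /\<^sub>R e n) /\<^sub>R e n = inverse w"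
        proof eventually_elim
          case (elim n)
          then have "norm (w /\<^sub>R e n) > 1" using e[of n] by (simp add: field_simps)
          then show ?case using e[of n] by (simp add: reg_kernel_eq_inverse inverse_scaleR_distrib)
        qed
        then show ?thesis by (rule tendsto_eventually)
      qed (simp add: reg_kernel_def)
    qed
  qed measurable
  have lim2: "(\<lambda>n. LINT w|lborel. F (e n *\<^sub>R w) * bump w) \<longlonglongrightarrow> (LINT w|lborel. F 0 * bump w)"
  proof (rule integral_dominated_convergence[where w = "\<lambda>w. M * bump w"])
    show "integrable lborel (\<lambda>w. M * bump w)" by (intro integrable_mult_right integrable_bump)
    show "AE w in lborel. norm (F (e n *\<^sub>R w) * of_real (bump w)) \<le> M * bump w" for n
      using M by (intro AE_I2) (auto simp: norm_mult bump_def intro!: mult_right_mono)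
    have "(\<lambda>n. F (e n *\<^sub>R w)) \<longlonglongrightarrow> F 0" for w
      by (rule continuous_on_tendsto_compose[OF contF])
        (use tendsto_scaleR[OF e0 tendsto_const[of w]] in auto)
    then show "AE w in lborel. (\<lambda>n. F (e n *\<^sub>R w) * of_real (bump w)) \<longlonglongrightarrow> F 0 * of_real (bump w)"
      by (intro AE_I2 tendsto_intros)
  qed measurable
  have "(\<lambda>n. - (LINT w|lborel. F (e n *\<^sub>R w) * bump w)) \<longlonglongrightarrow> (LINT w|lborel. dbar 1 \<i> F w * inverse w)"
    using lim1 integral_dbar_scaled_kernel[OF diff lip supp e(1)] by simp
  then have "(LINT w|lborel. dbar 1 \<i> F w * inverse w) = - (LINT w|lborel. F 0 * bump w)"
    using tendsto_minus[OF lim2] LIMSEQ_unique by blast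
  then show ?thesis by simp
qed

section \<open>The Cauchy transform in one variable\<close>

text \<open>The convolution runs along the single complex line \<open>\<iota>\<close>, and the shift
  is put into \<open>h\<close> rather than into the singular kernel, so that every derivative falls
  on \<open>h\<close>. The usual factor \<open>1 / pi\<close> is left out.\<close>

definition cauchy_transform :: "(complex \<Rightarrow> 'a) \<Rightarrow> ('a::euclidean_space \<Rightarrow> complex) \<Rightarrow> 'a \<Rightarrow> complex" where
  "cauchy_transform \<iota> h z = (LINT w|lborel. h (z - \<iota> w) * inverse w)"

context
  fixes \<iota> :: "complex \<Rightarrow> 'a::euclidean_space"
  assumes linear_iota: "linear \<iota>" and norm_iota: "\<And>w. norm (\<iota> w) = norm w"
begin

lemma continuous_on_iota: "continuous_on S \<iota>"
  using linear_iota by (simp add: linear_continuous_on linear_conv_bounded_linear)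

lemma continuous_on_shift_iota:
  assumes "continuous_on UNIV h"
  shows "continuous_on UNIV (\<lambda>w. h (z - \<iota> w))"
  by (intro continuous_on_compose2[OF assms] continuous_intros continuous_on_iota) auto

lemma shift_iota_outside:
  assumes "\<And>x. norm x > R \<Longrightarrow> h x = 0" "norm w > R + norm z"
  shows "h (z - \<iota> w) = 0"
  using assms(1)[of "z - \<iota> w"] assms(2) norm_triangle_ineq2[of "\<iota> w" z] norm_iota[of w]
  by (simp add: norm_minus_commute)

lemma integrable_cauchy_transform:
  assumes cont: "continuous_on UNIV h" and supp: "\<And>x. norm x > R \<Longrightarrow> h x = 0"
  shows "integrable lborel (\<lambda>w. h (z - \<iota> w) * inverse w)"
proof -
  obtain M where M: "M > 0" "\<And>x. norm (h x) \<le> M"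
    using continuous_compact_support_bounded[OF cont supp] by blast
  have m: "(\<lambda>w. h (z - \<iota> w)) \<in> borel_measurable borel"
    by (rule borel_measurable_continuous_onI[OF continuous_on_shift_iota[OF cont]])
  show ?thesis
  proof (rule Bochner_Integration.integrable_bound)
    show "integrable lborel (\<lambda>w::complex. M * (indicator (cball 0 (R + norm z)) w *\<^sub>R inverse (norm w)))"
      by (intro integrable_mult_right integrable_inverse_norm_cball)
    show "AE w in lborel. norm (h (z - \<iota> w) * inverse w)
        \<le> norm (M * (indicator (cball 0 (R + norm z)) w *\<^sub>R inverse (norm w)))"
      using M shift_iota_outside[of R h, OF supp]
      by (intro AE_I2) (auto simp: norm_mult norm_inverse indicator_def not_le intro!: mult_right_mono)
  qed (use m in measurable)
qed

text \<open>Differentiation under the integral: divided by the length of the increment, the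
  first-order remainder of \<open>h\<close> is at most \<open>2 * L\<close> and lives on a fixed
  ball, where \<open>1 / |w|\<close> is integrable.\<close>

lemma cauchy_transform_has_derivative:
  fixes h :: "'a \<Rightarrow> complex"
  assumes h: "smooth_up_to_boundary UNIV h" and supp: "\<And>x. norm x > R \<Longrightarrow> h x = 0"
  shows "(cauchy_transform \<iota> h has_derivative
    (\<lambda>v. cauchy_transform \<iota> (\<lambda>x. frechet_derivative h (at x) v) z)) (at z)"
proof -
  have dif: "h differentiable (at x)" for x
    using smooth_up_to_boundary_differentiable[OF h] by simp
  let ?D = "\<lambda>v x. frechet_derivative h (at x) v"
  have conth: "continuous_on UNIV h" by (rule smooth_UNIV_continuous[OF h])
  have contD: "continuous_on UNIV (?D v)" for v
    by (intro smooth_UNIV_continuous smooth_up_to_boundary_frechet_derivative h)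
  have suppD: "?D v x = 0" if "norm x > R" for v x
    by (rule frechet_derivative_outside_support[where R = R, OF supp that])
  note inth = integrable_cauchy_transform[OF conth supp]
  note intD = integrable_cauchy_transform[OF contD suppD]
  obtain L where L: "L-lipschitz_on UNIV h"
    using smooth_compact_support_lipschitz[OF h supp] by blast
  have L0: "L \<ge> 0" using L by (rule lipschitz_on_nonneg)
  have lin: "linear (\<lambda>v. cauchy_transform \<iota> (?D v) z)"
  proof
    show "cauchy_transform \<iota> (?D (u + v)) z = cauchy_transform \<iota> (?D u) z + cauchy_transform \<iota> (?D v) z" for u v
      unfolding cauchy_transform_def
      by (subst Bochner_Integration.integral_add[OF intD intD, symmetric])
        (simp_all add: linear_add[OF linear_frechet_derivative[OF dif]] algebra_simps)
    show "cauchy_transform \<iota> (?D (c *\<^sub>R v)) z = c *\<^sub>R cauchy_transform \<iota> (?D v) z" for c v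
      unfolding cauchy_transform_def
      by (simp add: linear_cmul[OF linear_frechet_derivative[OF dif]])
  qed
  have "((\<lambda>y. norm (cauchy_transform \<iota> h (z + y) - cauchy_transform \<iota> h z - cauchy_transform \<iota> (?D y) z) / norm y)
      \<longlongrightarrow> 0) (at 0)"
    \<comment> \<open>Dominated convergence speaks of sequences, so the limit at 0 is tested along
      an arbitrary sequence \<open>X\<close>.\<close>
    unfolding tendsto_at_iff_sequentially o_def
  proof (intro allI impI)
    fix X :: "nat \<Rightarrow> 'a" assume X0: "\<forall>i. X i \<in> UNIV - {0}" and X: "X \<longlonglongrightarrow> 0"
    \<comment> \<open>Since the increments are bounded by \<open>B\<close>, one ball of radius
      \<open>R + norm z + B\<close> contains the supports in \<open>w\<close> of all the
      integrands.\<close>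
    obtain B where B: "B > 0" "\<And>n. norm (X n) \<le> B"
      using convergent_imp_Bseq[OF convergentI[OF X]] by (auto simp: Bseq_def)
    define q where "q = (\<lambda>n w. inverse (norm (X n)) *\<^sub>R
      (h (z + X n - \<iota> w) * inverse w - h (z - \<iota> w) * inverse w - ?D (X n) (z - \<iota> w) * inverse w))"
    have q: "norm (LINT w|lborel. q n w)
        = norm (cauchy_transform \<iota> h (z + X n) - cauchy_transform \<iota> h z - cauchy_transform \<iota> (?D (X n)) z) / norm (X n)" for n
      unfolding q_def cauchy_transform_def using inth intD
      by (simp add: divide_inverse mult.commute)
    have q': "norm (q n w) = norm (h (z + X n - \<iota> w) - h (z - \<iota> w) - ?D (X n) (z - \<iota> w)) / norm (X n) * inverse (norm w)" for n w
    proof -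
      have "q n w = inverse (norm (X n)) *\<^sub>R ((h (z + X n - \<iota> w) - h (z - \<iota> w) - ?D (X n) (z - \<iota> w)) * inverse w)"
        unfolding q_def by (simp add: algebra_simps)
      then show ?thesis by (simp add: norm_mult norm_inverse divide_inverse mult_ac)
    qed
    have "(\<lambda>n. LINT w|lborel. q n w) \<longlonglongrightarrow> (LINT w|(lborel::complex measure). (0::complex))"
    proof (rule integral_dominated_convergence[where
          w = "\<lambda>w::complex. (2 * L) * (indicator (cball 0 (R + norm z + B)) w *\<^sub>R inverse (norm w))"])
      show "integrable lborel (\<lambda>w::complex. (2 * L) * (indicator (cball 0 (R + norm z + B)) w *\<^sub>R inverse (norm w)))"
        by (intro integrable_mult_right integrable_inverse_norm_cball)
      show "q n \<in> borel_measurable lborel" for n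
      proof -
        have "integrable lborel (q n)" unfolding q_def using inth intD by simp
        then show ?thesis by simp
      qed
      show "AE w in lborel. norm (q n w)
          \<le> (2 * L) * (indicator (cball 0 (R + norm z + B)) w *\<^sub>R inverse (norm w))" for n
      proof (intro AE_I2)
        fix w
        show "norm (q n w) \<le> (2 * L) * (indicator (cball 0 (R + norm z + B)) w *\<^sub>R inverse (norm w))"
        proof (cases "w \<in> cball 0 (R + norm z + B)")
          case True
          have "norm (h (z + X n - \<iota> w) - h (z - \<iota> w)) \<le> L * norm (X n)"
            using lipschitz_on_normD[OF L, of "z + X n - \<iota> w" "z - \<iota> w"] by simp
          moreover have "norm (?D (X n) (z - \<iota> w)) \<le> L * norm (X n)"
            by (rule norm_frechet_derivative_le[OF L dif])
          ultimately have "norm (h (z + X n - \<iota> w) - h (z - \<iota> w) - ?D (X n) (z - \<iota> w)) \<le> 2 * L * norm (X n)"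
            using norm_triangle_ineq4[of "h (z + X n - \<iota> w) - h (z - \<iota> w)" "?D (X n) (z - \<iota> w)"] by linarith
          then have "norm (h (z + X n - \<iota> w) - h (z - \<iota> w) - ?D (X n) (z - \<iota> w)) / norm (X n) \<le> 2 * L"
            using X0 by (simp add: divide_le_eq)
          from mult_right_mono[OF this, of "inverse (norm w)"]
          show ?thesis unfolding q' using True by simp
        next
          case False
          then have big: "norm w > R + norm z + B" by simp
          have "h (z - \<iota> w) = 0" using big B(1) by (intro shift_iota_outside[of R h, OF supp]) auto
          moreover have "?D (X n) (z - \<iota> w) = 0"
            using big B(1) by (intro shift_iota_outside[of R "?D (X n)", OF suppD]) auto
          moreover have "h (z + X n - \<iota> w) = 0"
          proof (rule shift_iota_outside[of R h, OF supp])
            have "norm (z + X n) \<le> norm z + B"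
              using norm_triangle_ineq[of z "X n"] B(2)[of n] by (rule order_trans[OF _ add_left_mono])
            then show "R + norm (z + X n) < norm w" using big by simp
          qed
          ultimately show ?thesis using False by (simp add: q')
        qed
      qed
      show "AE w in lborel. (\<lambda>n. q n w) \<longlonglongrightarrow> 0"
      proof (intro AE_I2)
        fix w
        have "((\<lambda>y. norm (h (z - \<iota> w + y) - h (z - \<iota> w) - ?D y (z - \<iota> w)) / norm y) \<longlongrightarrow> 0) (at 0)"
          using dif[of "z - \<iota> w"] by (simp add: frechet_derivative_works has_derivative_at)
        then have "(\<lambda>n. norm (h (z - \<iota> w + X n) - h (z - \<iota> w) - ?D (X n) (z - \<iota> w)) / norm (X n)) \<longlonglongrightarrow> 0"
          using X0 X unfolding tendsto_at_iff_sequentially o_def by blast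
        then have "(\<lambda>n. norm (h (z - \<iota> w + X n) - h (z - \<iota> w) - ?D (X n) (z - \<iota> w)) / norm (X n) * inverse (norm w)) \<longlonglongrightarrow> 0"
          by (rule tendsto_mult_left_zero)
        then have "(\<lambda>n. norm (q n w)) \<longlonglongrightarrow> 0" unfolding q' by (simp add: algebra_simps)
        then show "(\<lambda>n. q n w) \<longlonglongrightarrow> 0" by (rule tendsto_norm_zero_cancel)
      qed
    qed auto
    from tendsto_norm_zero[OF this[simplified]]
    show "(\<lambda>n. norm (cauchy_transform \<iota> h (z + X n) - cauchy_transform \<iota> h z - cauchy_transform \<iota> (?D (X n)) z) / norm (X n))
      \<longlonglongrightarrow> 0" unfolding q .
  qed
  then show ?thesis using lin by (simp add: has_derivative_at linear_conv_bounded_linear)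
qed

text \<open>The derivative of a transform is the transform of the derivative, so the transforms of
  smooth compactly supported functions are closed under differentiation and plain coinduction
  suffices.\<close>

lemma smooth_cauchy_transform:
  fixes h :: "'a \<Rightarrow> complex"
  assumes h: "smooth_up_to_boundary UNIV h" and supp: "\<And>x. norm x > R \<Longrightarrow> h x = 0" and "open S"
  shows "smooth_up_to_boundary S (cauchy_transform \<iota> h)"
proof (rule smooth_up_to_boundary_coinduct[OF \<open>open S\<close>, of "\<lambda>f. \<exists>h R. f = cauchy_transform \<iota> h \<and>
    smooth_up_to_boundary UNIV h \<and> (\<forall>x. norm x > R \<longrightarrow> h x = 0)"], goal_cases)
  case 1
  then show ?case using assms by blast
next
  case (2 f x)
  then show ?case using cauchy_transform_has_derivative unfolding differentiable_def by metis
next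
  case (3 f)
  then obtain h R where hR: "f = cauchy_transform \<iota> h" "smooth_up_to_boundary UNIV h" "\<And>x. norm x > R \<Longrightarrow> h x = 0"
    by blast
  then have "continuous_on UNIV f"
    using has_derivative_continuous[OF cauchy_transform_has_derivative[of h R, OF hR(2,3)]]
    by (intro continuous_at_imp_continuous_on) auto
  then show ?case using continuous_on_subset by blast
next
  case (4 f v)
  then obtain h R where hR: "f = cauchy_transform \<iota> h" "smooth_up_to_boundary UNIV h" "\<And>x. norm x > R \<Longrightarrow> h x = 0"
    by blast
  have "frechet_derivative f (at x) v = cauchy_transform \<iota> (\<lambda>x. frechet_derivative h (at x) v) x" for x
    using frechet_derivative_at[OF cauchy_transform_has_derivative[of h R x, OF hR(2,3)]]
    unfolding hR(1) by metis
  moreover have "smooth_up_to_boundary UNIV (\<lambda>x. frechet_derivative h (at x) v)"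
    by (rule smooth_up_to_boundary_frechet_derivative[OF hR(2)])
  moreover have "frechet_derivative h (at x) v = 0" if "norm x > R" for x
    by (rule frechet_derivative_outside_support[where R = R, OF hR(3) that])
  ultimately show ?case by blast
qed

text \<open>This is the formula at 0 applied to \<open>h (z - \<iota> w)\<close> as a function of
  \<open>w\<close>. The sign from differentiating \<open>- \<iota> w\<close> cancels the sign in
  \<open>integral_dbar_inverse\<close>.\<close>

lemma dbar_cauchy_transform:
  fixes h :: "'a \<Rightarrow> complex"
  assumes h: "smooth_up_to_boundary UNIV h" and supp: "\<And>x. norm x > R \<Longrightarrow> h x = 0"
  shows "dbar (\<iota> 1) (\<iota> \<i>) (cauchy_transform \<iota> h) z = h z * (LINT w|lborel. bump w)"
proof -
  have dif: "h differentiable (at x)" for x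
    using smooth_up_to_boundary_differentiable[OF h] by simp
  let ?D = "\<lambda>v x. frechet_derivative h (at x) v"
  have contD: "continuous_on UNIV (?D v)" for v
    by (intro smooth_UNIV_continuous smooth_up_to_boundary_frechet_derivative h)
  have suppD: "?D v x = 0" if "norm x > R" for v x
    by (rule frechet_derivative_outside_support[where R = R, OF supp that])
  note intD = integrable_cauchy_transform[OF contD suppD]
  obtain L where L: "L-lipschitz_on UNIV h"
    using smooth_compact_support_lipschitz[OF h supp] by blast
  define F where "F = (\<lambda>w. h (z - \<iota> w))"
  have DF: "(F has_derivative (\<lambda>v. - ?D (\<iota> v) (z - \<iota> w))) (at w)" for w
  proof -
    have "((\<lambda>w. z - \<iota> w) has_derivative (\<lambda>v. - \<iota> v)) (at w)"
      using linear_iota by (auto intro!: derivative_eq_intros linear_imp_has_derivative)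
    then have "(F has_derivative (\<lambda>v. ?D (- \<iota> v) (z - \<iota> w))) (at w)"
      unfolding F_def by (rule has_derivative_compose) (use dif in \<open>simp add: frechet_derivative_works[symmetric]\<close>)
    then show ?thesis by (simp add: linear_neg[OF linear_frechet_derivative[OF dif]])
  qed
  have "(LINT w|lborel. dbar 1 \<i> F w * inverse w) = - F 0 * (LINT w|lborel. bump w)"
  proof (rule integral_dbar_inverse)
    show "F differentiable (at w)" for w using DF unfolding differentiable_def by blast
    show "L-lipschitz_on UNIV F"
    proof (rule lipschitz_onI)
      show "dist (F x) (F y) \<le> L * dist x y" for x y
        using lipschitz_on_normD[OF L, of "z - \<iota> x" "z - \<iota> y"] norm_iota[of "y - x"]
        by (simp add: F_def dist_norm linear_diff[OF linear_iota] norm_minus_commute)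
    qed (use L in \<open>rule lipschitz_on_nonneg\<close>)
    show "F w = 0" if "norm w > R + norm z" for w
      unfolding F_def by (rule shift_iota_outside[of R h, OF supp that])
  qed
  moreover have "dbar 1 \<i> F w * inverse w
      = - ((?D (\<iota> 1) (z - \<iota> w) * inverse w + \<i> * (?D (\<iota> \<i>) (z - \<iota> w) * inverse w)) / 2)" for w
    unfolding dbar_eqI[OF DF] by (simp add: algebra_simps add_divide_distrib diff_divide_distrib)
  ultimately have "(cauchy_transform \<iota> (?D (\<iota> 1)) z + \<i> * cauchy_transform \<iota> (?D (\<iota> \<i>)) z) / 2
      = h z * (LINT w|lborel. bump w)"
    unfolding cauchy_transform_def using intD by (simp add: F_def linear_0[OF linear_iota])
  then show ?thesis
    by (subst dbar_eqI[OF cauchy_transform_has_derivative[of h R, OF h supp]])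
qed

end

section \<open>Integration against holomorphic functions\<close>

lemma smooth_up_to_boundary_bounded:
  fixes f :: "'a::euclidean_space \<Rightarrow> 'b::real_normed_vector"
  assumes "bounded S" "smooth_up_to_boundary S f"
  obtains B where "B > 0" "\<And>x. x \<in> S \<Longrightarrow> norm (f x) \<le> B"
proof -
  obtain F where F: "continuous_on (closure S) F" "\<And>x. x \<in> S \<Longrightarrow> F x = f x"
    using smooth_up_to_boundary_extension[OF assms(2)] by blast
  have "bounded (F ` closure S)"
    using assms(1) by (intro compact_imp_bounded compact_continuous_image F) (simp add: compact_closure)
  then obtain B where "B > 0" "\<And>x. x \<in> closure S \<Longrightarrow> norm (F x) \<le> B"
    by (auto simp: bounded_pos)
  then show ?thesis using that[of B] F(2) closure_subset by force
qed

lemma smooth_up_to_boundary_continuous_on: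
  assumes "smooth_up_to_boundary S f"
  shows "continuous_on S f"
  using smooth_up_to_boundary_differentiable[OF assms]
  by (intro continuous_at_imp_continuous_on) (auto intro: differentiable_imp_continuous_within)

lemma measurable_indicator_mult:
  fixes \<eta> f :: "'a::euclidean_space \<Rightarrow> complex"
  assumes "open S" "set_integrable lborel S \<eta>" "continuous_on S f"
  shows "(\<lambda>z. indicator S z *\<^sub>R (\<eta> z * f z)) \<in> borel_measurable lborel"
proof -
  have [measurable]: "(\<lambda>z. indicator S z *\<^sub>R \<eta> z) \<in> borel_measurable lborel"
    using assms(2) by (auto simp: set_integrable_def)
  have [measurable]: "(\<lambda>z. indicator S z *\<^sub>R f z) \<in> borel_measurable lborel"
    using borel_measurable_continuous_on_indicator[OF _ assms(3)] assms(1) by simp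
  have "(\<lambda>z. (indicator S z *\<^sub>R \<eta> z) * (indicator S z *\<^sub>R f z)) \<in> borel_measurable lborel"
    by measurable
  also have "(\<lambda>z. (indicator S z *\<^sub>R \<eta> z) * (indicator S z *\<^sub>R f z)) = (\<lambda>z. indicator S z *\<^sub>R (\<eta> z * f z))"
    by (auto simp: indicator_def)
  finally show ?thesis .
qed

lemma set_integrable_mult_smooth:
  fixes \<eta> f :: "'a::euclidean_space \<Rightarrow> complex"
  assumes "open S" "bounded S" "set_integrable lborel S \<eta>" "smooth_up_to_boundary S f"
  shows "set_integrable lborel S (\<lambda>z. \<eta> z * f z)"
proof -
  obtain B where B: "B > 0" "\<And>x. x \<in> S \<Longrightarrow> norm (f x) \<le> B"
    using smooth_up_to_boundary_bounded[OF assms(2,4)] by blast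
  show ?thesis unfolding set_integrable_def
  proof (rule Bochner_Integration.integrable_bound)
    show "integrable lborel (\<lambda>z. B *\<^sub>R (indicator S z *\<^sub>R \<eta> z))"
      using assms(3) by (intro integrable_scaleR_right) (simp add: set_integrable_def)
    show "(\<lambda>z. indicator S z *\<^sub>R (\<eta> z * f z)) \<in> borel_measurable lborel"
      by (rule measurable_indicator_mult[OF assms(1,3) smooth_up_to_boundary_continuous_on[OF assms(4)]])
    show "AE z in lborel. norm (indicator S z *\<^sub>R (\<eta> z * f z)) \<le> norm (B *\<^sub>R (indicator S z *\<^sub>R \<eta> z))"
      using B by (intro AE_I2) (auto simp: indicator_def norm_mult mult.commute[of B] intro!: mult_left_mono)
  qed
qed

lemma smooth_up_to_boundary_UNIV_iff:
  "smooth_up_to_boundary UNIV f \<longleftrightarrow> smooth_on UNIV f"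
  unfolding smooth_up_to_boundary_def smooth_on_def closure_UNIV
  by (metis UNIV_I continuous_at_imp_continuous_on differentiable_imp_continuous_within)

lemma iter_deriv_0: "iter_deriv vs (\<lambda>_. 0) = (\<lambda>_. 0)"
  by (induction vs) auto

lemma smooth_extend_by_zero:
  fixes u :: "'a::euclidean_space \<Rightarrow> complex"
  assumes "open \<Omega>" "smooth_up_to_boundary \<Omega> u" "s > 0"
    and zero: "\<And>z. z \<in> \<Omega> \<Longrightarrow> infdist z (frontier \<Omega>) < s \<Longrightarrow> u z = 0"
  shows "smooth_up_to_boundary UNIV (\<lambda>z. if z \<in> \<Omega> then u z else 0)"
  unfolding smooth_up_to_boundary_UNIV_iff smooth_on_def
proof (intro allI ballI)
  let ?u = "\<lambda>z. if z \<in> \<Omega> then u z else 0"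
  \<comment> \<open>An open neighbourhood of the complement of \<Omega>: a point outside \<Omega> is
    either off the closure or on the frontier, where the distance is 0. The extension vanishes on
    it, so the space is covered by two open sets on which smoothness is known.\<close>
  let ?M = "{z. infdist z (frontier \<Omega>) < s} \<union> - closure \<Omega>"
  have "open ?M"
    by (intro open_Un open_Collect_less continuous_intros open_Compl closed_closure)
  fix vs z
  show "iter_deriv vs ?u differentiable (at z)"
  proof (cases "z \<in> \<Omega>")
    case True
    have "iter_deriv vs u differentiable (at z)"
      using assms(2) True unfolding smooth_up_to_boundary_def smooth_on_def by blast
    then show ?thesis
      by (rule differentiable_cong_open[OF \<open>open \<Omega>\<close> True, rotated])
        (rule iter_deriv_cong_open[OF \<open>open \<Omega>\<close>], auto)
  next
    case False
    then have "z \<in> ?M"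
      using \<open>s > 0\<close> \<open>open \<Omega>\<close> by (cases "z \<in> closure \<Omega>") (auto simp: frontier_def interior_open)
    moreover have "?u y = 0" if "y \<in> ?M" for y
      using that zero closure_subset[of \<Omega>] by auto
    then have "iter_deriv vs ?u y = 0" if "y \<in> ?M" for y
      using iter_deriv_cong_open[OF \<open>open ?M\<close>, of ?u "\<lambda>_. 0" y vs] that by (simp add: iter_deriv_0)
    ultimately show ?thesis
      using differentiable_cong_open[OF \<open>open ?M\<close>, of z "\<lambda>_. 0" "iter_deriv vs ?u"] by simp
  qed
qed

section \<open>Cauchy estimates in several variables\<close>

lemma norm_vector_scalar_mult: "norm (t *s (x :: complex ^ 'n)) = norm t * norm x"
  by (simp add: norm_vec_def vector_scalar_mult_def norm_mult L2_set_right_distrib)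

lemma holomorphic_on_vec_differentiable:
  assumes "holomorphic_on_vec \<eta> \<Omega>" "z \<in> \<Omega>"
  shows "\<eta> differentiable (at z)"
  using assms unfolding holomorphic_on_vec_def differentiable_def by blast

lemma holomorphic_on_vec_derivative_scale:
  assumes "holomorphic_on_vec \<eta> \<Omega>" "z \<in> \<Omega>"
  shows "frechet_derivative \<eta> (at z) (c *s v) = c * frechet_derivative \<eta> (at z) v"
proof -
  obtain D where "(\<eta> has_derivative D) (at z)" "\<forall>c v. D (c *s v) = c * D v"
    using assms unfolding holomorphic_on_vec_def by blast
  with frechet_derivative_at[of \<eta> D z] show ?thesis by simp
qed

lemma dbar_holomorphic_on_vec:
  assumes "holomorphic_on_vec \<eta> \<Omega>" "z \<in> \<Omega>"
  shows "dbar e (\<i> *s e) \<eta> z = 0"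
  by (simp add: dbar_def holomorphic_on_vec_derivative_scale[OF assms])

text \<open>Restricted to a complex line, \<eta> is holomorphic in one variable, so the Cauchy
  inequality bounds its derivative in each unit direction. In this way a definition that asks only
  for differentiability yields locally bounded derivatives.\<close>

lemma holomorphic_on_vec_derivative_bound:
  fixes \<eta> :: "complex ^ 'n \<Rightarrow> complex"
  assumes hol: "holomorphic_on_vec \<eta> \<Omega>" and "open \<Omega>" "compact K" "K \<subseteq> \<Omega>"
  obtains B where "B > 0" "\<And>z v. z \<in> K \<Longrightarrow> norm (frechet_derivative \<eta> (at z) v) \<le> B * norm v"
proof -
  obtain r where r: "r > 0" "(\<Union>x\<in>K. cball x r) \<subseteq> \<Omega>"
    using compact_subset_open_imp_cball_epsilon_subset[OF assms(3,2,4)] by blast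
  \<comment> \<open>The closed neighbourhood of \<open>K\<close> of radius \<open>r\<close> contains
    all the discs used below and is still compact inside \<Omega>, so \<eta> is bounded on
    it.\<close>
  define K' where "K' = {x + y | x y. x \<in> K \<and> y \<in> cball 0 r}"
  have "compact K'" unfolding K'_def by (intro compact_sums assms compact_cball)
  have K'\<Omega>: "K' \<subseteq> \<Omega>" using r(2) by (force simp: K'_def dist_norm)
  have cont: "continuous_on \<Omega> \<eta>"
    using holomorphic_on_vec_differentiable[OF hol]
    by (intro continuous_at_imp_continuous_on) (auto intro: differentiable_imp_continuous_within)
  have "bounded (\<eta> ` K')"
    by (intro compact_imp_bounded compact_continuous_image \<open>compact K'\<close> continuous_on_subset[OF cont K'\<Omega>])
  then obtain M where M: "M > 0" "\<And>x. x \<in> K' \<Longrightarrow> norm (\<eta> x) \<le> M"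
    by (auto simp: bounded_pos)
  have unit: "norm (frechet_derivative \<eta> (at z) u) \<le> M / r" if z: "z \<in> K" and u: "norm u = 1" for z u
  proof -
    define f where "f = (\<lambda>t. \<eta> (z + t *s u))"
    have in_K': "z + t *s u \<in> K'" if "norm t \<le> r" for t
      unfolding K'_def using that z u
      by (intro CollectI exI[of _ z] exI[of _ "t *s u"]) (simp add: norm_vector_scalar_mult)
    have D: "(f has_field_derivative frechet_derivative \<eta> (at (z + t *s u)) u) (at t)" if "norm t \<le> r" for t
    proof -
      have lin: "linear (\<lambda>t. t *s u)"
        by (rule linearI) (simp_all add: vec_eq_iff distrib_right)
      have "((\<lambda>t. z + t *s u) has_derivative (\<lambda>t. t *s u)) (at t)"
        by (rule has_derivative_eq_rhs[OF has_derivative_add[OF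
                has_derivative_const[of z] linear_imp_has_derivative[OF lin]]]) (simp only: add_0_left)
      moreover have in_\<Omega>: "z + t *s u \<in> \<Omega>" using in_K'[OF that] K'\<Omega> by blast
      then have "(\<eta> has_derivative frechet_derivative \<eta> (at (z + t *s u))) (at (z + t *s u))"
        using holomorphic_on_vec_differentiable[OF hol] frechet_derivative_works by blast
      ultimately have "(f has_derivative (\<lambda>h. frechet_derivative \<eta> (at (z + t *s u)) (h *s u))) (at t)"
        unfolding f_def by (rule has_derivative_compose)
      then show ?thesis
        unfolding has_field_derivative_def
      proof (rule has_derivative_eq_rhs)
        from holomorphic_on_vec_derivative_scale[OF hol in_\<Omega>]
        show "(\<lambda>h. frechet_derivative \<eta> (at (z + t *s u)) (h *s u)) = (*) (frechet_derivative \<eta> (at (z + t *s u)) u)"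
          by (simp add: fun_eq_iff mult.commute)
      qed
    qed
    have "norm ((deriv ^^ 1) f 0) \<le> fact 1 * M / r ^ 1"
    proof (rule Cauchy_inequality)
      show "f holomorphic_on ball 0 r"
      proof (rule holomorphic_onI)
        show "f field_differentiable (at t within ball 0 r)" if "t \<in> ball 0 r" for t
          using has_field_derivative_at_within[OF D[of t]] that by (auto simp: field_differentiable_def)
      qed
      show "continuous_on (cball 0 r) f"
        by (intro continuous_at_imp_continuous_on ballI DERIV_isCont[OF D]) simp
      show "norm (f x) \<le> M" if "norm (0 - x) = r" for x
        using M(2)[OF in_K'[of x]] that by (simp add: f_def)
    qed (use r in auto)
    moreover have "deriv f 0 = frechet_derivative \<eta> (at z) u"
      using DERIV_imp_deriv[OF D[of 0]] r(1) by simp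
    ultimately show ?thesis by simp
  qed
  have lin: "linear (frechet_derivative \<eta> (at z))" if "z \<in> K" for z
    by (rule linear_frechet_derivative[OF holomorphic_on_vec_differentiable[OF hol]])
      (use that assms(4) in blast)
  have "norm (frechet_derivative \<eta> (at z) v) \<le> (M / r) * norm v" if z: "z \<in> K" for z v
  proof (cases "v = 0")
    case True
    then show ?thesis by (simp add: linear_0[OF lin[OF z]])
  next
    case False
    have "norm (frechet_derivative \<eta> (at z) (v /\<^sub>R norm v)) \<le> M / r"
      using False by (intro unit z) simp
    then show ?thesis using False by (simp add: linear_cmul[OF lin[OF z]] field_simps)
  qed
  then show ?thesis using that[of "M / r"] M(1) r(1) by simp
qed

text \<open>Extended by zero, \<open>\<eta> * u\<close> is Lipschitz on the whole space, and as
  \<eta> is holomorphic its Cauchy-Riemann derivative is \<eta> times that of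
  \<open>u\<close>.\<close>

lemma integral_holomorphic_dbar_compact_support:
  fixes \<eta> u :: "complex ^ 'n \<Rightarrow> complex"
  assumes \<Omega>: "open \<Omega>" "bounded \<Omega>" and hol: "holomorphic_on_vec \<eta> \<Omega>"
    and u: "smooth_up_to_boundary \<Omega> u" and "s > 0"
    and zero: "\<And>z. z \<in> \<Omega> \<Longrightarrow> infdist z (frontier \<Omega>) < s \<Longrightarrow> u z = 0"
  shows "(LINT z:\<Omega>|lborel. \<eta> z * dbar e (\<i> *s e) u z) = 0"
proof -
  \<comment> \<open>All bounds on \<eta> are taken on this compact set, off which \<open>u\<close>
    vanishes.\<close>
  define K where "K = closure \<Omega> \<inter> {z. infdist z (frontier \<Omega>) \<ge> s}"
  have "compact K" unfolding K_def
    using \<Omega>(2) by (intro compact_Int_closed closed_Collect_le continuous_intros) (auto simp: compact_closure)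
  have K\<Omega>: "K \<subseteq> \<Omega>"
  proof
    fix z assume z: "z \<in> K"
    then have "z \<notin> frontier \<Omega>" using \<open>s > 0\<close> by (auto simp: K_def)
    then show "z \<in> \<Omega>" using z \<Omega>(1) by (simp add: K_def frontier_def interior_open)
  qed
  have outK: "z \<in> \<Omega> \<Longrightarrow> z \<notin> K \<Longrightarrow> u z = 0" for z
    using zero[of z] subsetD[OF closure_subset, of z \<Omega>] by (force simp: K_def)
  define F where "F = (\<lambda>z. if z \<in> \<Omega> then \<eta> z * u z else 0)"
  have F0: "F z = 0" if "z \<notin> K" for z using outK that by (simp add: F_def)
  have opK: "open (- K)" using \<open>compact K\<close> by (simp add: compact_imp_closed open_Compl)
  have dF0: "frechet_derivative F (at z) v = 0" if "z \<notin> K" for z v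
    by (rule frechet_derivative_eq_0_open[OF opK]) (simp_all add: F0 that)
  have de: "\<eta> differentiable (at z)" and du: "u differentiable (at z)" if "z \<in> \<Omega>" for z
    using holomorphic_on_vec_differentiable[OF hol that] smooth_up_to_boundary_differentiable[OF u that] by auto
  have dF: "F differentiable (at z)" for z
  proof (cases "z \<in> \<Omega>")
    case True
    show ?thesis
      by (rule differentiable_cong_open[OF \<Omega>(1) True, of "\<lambda>z. \<eta> z * u z"])
        (simp add: F_def, intro differentiable_mult de du True)
  next
    case False
    show ?thesis
      by (rule differentiable_cong_open[OF opK, of z "\<lambda>_. 0"]) (use False K\<Omega> in \<open>auto simp: F0\<close>)
  qed
  have DF: "frechet_derivative F (at z) v
      = \<eta> z * frechet_derivative u (at z) v + frechet_derivative \<eta> (at z) v * u z" if "z \<in> \<Omega>" for z v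
  proof -
    have "frechet_derivative F (at z) = frechet_derivative (\<lambda>z. \<eta> z * u z) (at z)"
      by (rule frechet_derivative_cong_open[OF \<Omega>(1) that]) (simp add: F_def)
    then show ?thesis by (simp add: frechet_derivative_times[OF de[OF that] du[OF that]])
  qed
  obtain B1 where B1: "B1 > 0" "\<And>z v. z \<in> K \<Longrightarrow> norm (frechet_derivative \<eta> (at z) v) \<le> B1 * norm v"
    using holomorphic_on_vec_derivative_bound[OF hol \<Omega>(1) \<open>compact K\<close> K\<Omega>] by blast
  have "continuous_on K \<eta>"
    by (intro continuous_at_imp_continuous_on ballI differentiable_imp_continuous_within de) (use K\<Omega> in blast)
  then have "bounded (\<eta> ` K)" by (intro compact_imp_bounded compact_continuous_image \<open>compact K\<close>)
  then obtain B2 where B2: "B2 > 0" "\<And>z. z \<in> K \<Longrightarrow> norm (\<eta> z) \<le> B2" by (auto simp: bounded_pos)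
  obtain B3 where B3: "B3 > 0" "\<And>z. z \<in> \<Omega> \<Longrightarrow> norm (u z) \<le> B3"
    using smooth_up_to_boundary_bounded[OF \<Omega>(2) u] by blast
  obtain R where "\<forall>x\<in>K. norm x \<le> R"
    using compact_imp_bounded[OF \<open>compact K\<close>] unfolding bounded_iff by blast
  then have R: "K \<subseteq> cball 0 R" by auto
  \<comment> \<open>The Lipschitz constant of the zero extension bounds the derivative of
    \<open>u\<close> in all directions at once.\<close>
  have ext: "smooth_up_to_boundary UNIV (\<lambda>z. if z \<in> \<Omega> then u z else 0)"
    by (rule smooth_extend_by_zero[OF \<Omega>(1) u \<open>s > 0\<close> zero])
  have "\<exists>L. L-lipschitz_on UNIV (\<lambda>z. if z \<in> \<Omega> then u z else 0)"
  proof (rule smooth_compact_support_lipschitz[OF ext, of R])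
    show "(if z \<in> \<Omega> then u z else 0) = 0" if "norm z > R" for z
    proof -
      have "z \<notin> K" using that R by auto
      then show ?thesis using outK by simp
    qed
  qed (rule exI)
  then obtain L where L: "L-lipschitz_on UNIV (\<lambda>z. if z \<in> \<Omega> then u z else 0)" ..
  have B4: "norm (frechet_derivative u (at z) v) \<le> L * norm v" if "z \<in> \<Omega>" for z v
  proof -
    have "frechet_derivative u (at z) = frechet_derivative (\<lambda>z. if z \<in> \<Omega> then u z else 0) (at z)"
      by (rule frechet_derivative_cong_open[OF \<Omega>(1) that]) simp
    then show ?thesis
      using norm_frechet_derivative_le[OF L] smooth_up_to_boundary_differentiable[OF ext] by simp
  qed
  have L0: "L \<ge> 0" using L by (rule lipschitz_on_nonneg)
  have lip: "(B2 * L + B1 * B3)-lipschitz_on UNIV F"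
  proof (rule lipschitz_on_UNIV_if_derivative_bounded[OF dF])
    show "0 \<le> B2 * L + B1 * B3" using B1 B2 B3 L0 by simp
    show "norm (frechet_derivative F (at z) v) \<le> (B2 * L + B1 * B3) * norm v" for z v
    proof (cases "z \<in> K")
      case True
      then have z: "z \<in> \<Omega>" using K\<Omega> by blast
      have "norm (frechet_derivative F (at z) v) \<le> norm (\<eta> z) * norm (frechet_derivative u (at z) v)
          + norm (frechet_derivative \<eta> (at z) v) * norm (u z)"
        unfolding DF[OF z] by (rule order_trans[OF norm_triangle_ineq]) (simp add: norm_mult)
      also have "\<dots> \<le> B2 * (L * norm v) + (B1 * norm v) * B3"
        using B1 B2 B3 B4 L0 z True by (intro add_mono mult_mono) auto
      finally show ?thesis by (simp add: algebra_simps)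
    qed (use dF0 B1 B2 B3 L0 in simp)
  qed
  have "(LINT z:\<Omega>|lborel. \<eta> z * dbar e (\<i> *s e) u z) = (LINT z|lborel. dbar e (\<i> *s e) F z)"
    unfolding set_lebesgue_integral_def
  proof (rule Bochner_Integration.integral_cong)
    fix z
    show "indicator \<Omega> z *\<^sub>R (\<eta> z * dbar e (\<i> *s e) u z) = dbar e (\<i> *s e) F z"
    proof (cases "z \<in> \<Omega>")
      case True
      have "dbar e (\<i> *s e) F z = \<eta> z * dbar e (\<i> *s e) u z + dbar e (\<i> *s e) \<eta> z * u z"
        unfolding dbar_def DF[OF True] by (simp add: distrib_left distrib_right add_divide_distrib mult_ac)
      then show ?thesis using True by (simp add: dbar_holomorphic_on_vec[OF hol True])
    next
      case False
      then have "z \<notin> K" using K\<Omega> by blast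
      then show ?thesis using False by (simp add: dbar_def dF0)
    qed
  qed simp
  also have "\<dots> = 0"
  proof (rule integral_dbar_eq_0[OF dF lip, of R])
    show "F z = 0" if "norm z > R" for z
      using that R by (intro F0) auto
  qed
  finally show ?thesis .
qed

section \<open>Cutoffs as functions of the boundary distance\<close>

abbreviation smooth_step_deriv :: "nat \<Rightarrow> real \<Rightarrow> real" where
  "smooth_step_deriv n \<equiv> iter_deriv (replicate n 1) smooth_step"

lemma smooth_step_deriv_has_derivative:
  "(smooth_step_deriv n has_real_derivative smooth_step_deriv (Suc n) t) (at t)"
proof -
  let ?f = "smooth_step_deriv n"
  have "?f differentiable (at t)"
    using smooth_smooth_step unfolding smooth_up_to_boundary_def smooth_on_def by blast
  then have D: "(?f has_derivative frechet_derivative ?f (at t)) (at t)"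
    by (simp only: frechet_derivative_works)
  have "frechet_derivative ?f (at t) v = smooth_step_deriv (Suc n) t * v" for v
    using linear_cmul[OF has_derivative_linear[OF D], of v 1]
    by (simp only: replicate_Suc iter_deriv.simps real_scaleR_def mult_1_right mult_1_left mult.commute)
  then have "frechet_derivative ?f (at t) = (*) (smooth_step_deriv (Suc n) t)" by (rule ext)
  with D show ?thesis unfolding has_field_derivative_def by (simp only:)
qed

text \<open>The inequality is strict because a derivative at \<open>t\<close> needs a whole
  neighbourhood on which the step is constant.\<close>

lemma smooth_step_deriv_beyond_2: "t > 2 \<Longrightarrow> smooth_step_deriv n t = (if n = 0 then 1 else 0)"
proof (induction n arbitrary: t)
  case (Suc n)
  have "frechet_derivative (smooth_step_deriv n) (at t) = frechet_derivative (\<lambda>_. if n = 0 then 1 else 0) (at t)"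
    by (rule frechet_derivative_cong_open[OF open_greaterThan[of 2]]) (simp_all only: greaterThan_iff Suc)
  then show ?case by (simp only: replicate_Suc iter_deriv.simps frechet_derivative_const) simp
qed (simp add: smooth_step_1)

lemma continuous_on_smooth_step_deriv: "continuous_on S (smooth_step_deriv n)"
  by (intro continuous_at_imp_continuous_on ballI DERIV_isCont[OF smooth_step_deriv_has_derivative])

lemma smooth_step_deriv_bounded:
  obtains B where "B > 0" "\<And>t. t \<ge> 0 \<Longrightarrow> \<bar>smooth_step_deriv n t\<bar> \<le> B"
proof -
  have "bounded (smooth_step_deriv n ` {0..2})"
    by (intro compact_imp_bounded compact_continuous_image continuous_on_smooth_step_deriv) auto
  then obtain B where B: "\<And>t. t \<in> {0..2} \<Longrightarrow> \<bar>smooth_step_deriv n t\<bar> \<le> B" unfolding bounded_real by blast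
  have "\<bar>smooth_step_deriv n t\<bar> \<le> max 1 B" if "t \<ge> 0" for t
  proof (cases "t \<le> 2")
    case True
    then show ?thesis using B[of t] that by auto
  next
    case False
    then show ?thesis by (auto simp: smooth_step_deriv_beyond_2)
  qed
  then show ?thesis using that[of "max 1 B"] by simp
qed

text \<open>Far from the frontier the distance need not be smooth, but there the step is already
  constant. Hence \<open>s\<close> must be small compared with the collar on which the distance
  coincides with \<open>\<delta>\<close>.\<close>

definition cutoff :: "'a::metric_space set \<Rightarrow> real \<Rightarrow> 'a \<Rightarrow> complex" where
  "cutoff \<Omega> s z = of_real (smooth_step (infdist z (frontier \<Omega>) / s))"

lemma cutoff_eq_0: "s > 0 \<Longrightarrow> infdist z (frontier \<Omega>) < s \<Longrightarrow> cutoff \<Omega> s z = 0"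
  by (simp add: cutoff_def smooth_step_0)

lemma cutoff_eq_1: "s > 0 \<Longrightarrow> infdist z (frontier \<Omega>) \<ge> 2 * s \<Longrightarrow> cutoff \<Omega> s z = 1"
  by (simp add: cutoff_def smooth_step_1 field_simps)

context
  fixes \<Omega> :: "'a::euclidean_space set" and \<delta> :: "'a \<Rightarrow> complex" and s0 :: real
  assumes \<Omega>: "open \<Omega>" "bounded \<Omega>" and delta: "smooth_up_to_boundary \<Omega> \<delta>" and s0: "s0 > 0"
    and delta_eq: "\<And>z. z \<in> \<Omega> \<Longrightarrow> infdist z (frontier \<Omega>) < s0 \<Longrightarrow> \<delta> z = of_real (infdist z (frontier \<Omega>))"
begin

lemma collar_open: "open {z \<in> \<Omega>. infdist z (frontier \<Omega>) < s0}"
  using open_Int[OF \<Omega>(1) open_Collect_less[of "\<lambda>z. infdist z (frontier \<Omega>)" "\<lambda>_. s0"]]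
  by (simp add: continuous_intros Int_def)

lemma infdist_has_derivative_collar:
  assumes "z \<in> \<Omega>" "infdist z (frontier \<Omega>) < s0"
  shows "((\<lambda>z. infdist z (frontier \<Omega>)) has_derivative (\<lambda>v. Re (frechet_derivative \<delta> (at z) v))) (at z)"
proof -
  have "(\<delta> has_derivative frechet_derivative \<delta> (at z)) (at z)"
    using smooth_up_to_boundary_differentiable[OF delta assms(1)] by (simp add: frechet_derivative_works[symmetric])
  then have "((\<lambda>z. Re (\<delta> z)) has_derivative (\<lambda>v. Re (frechet_derivative \<delta> (at z) v))) (at z)"
    by (rule has_derivative_Re)
  then show ?thesis
    by (rule has_derivative_transform_within_open[OF _ collar_open]) (use assms in \<open>auto simp: delta_eq\<close>)
qed

text \<open>In the collar \<open>\<delta>\<close> is real-valued, hence so are its derivatives. This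
  later makes \<open>(a - \<i> * b) * (a + \<i> * b)\<close> a sum of squares of real
  numbers.\<close>

lemma delta_derivative_collar:
  assumes "z \<in> \<Omega>" "infdist z (frontier \<Omega>) < s0"
  shows "frechet_derivative \<delta> (at z) v = of_real (Re (frechet_derivative \<delta> (at z) v))"
proof -
  have "((\<lambda>z. complex_of_real (infdist z (frontier \<Omega>))) has_derivative
      (\<lambda>v. of_real (Re (frechet_derivative \<delta> (at z) v)))) (at z)"
    by (rule has_derivative_of_real[OF infdist_has_derivative_collar[OF assms]])
  then have "(\<delta> has_derivative (\<lambda>v. of_real (Re (frechet_derivative \<delta> (at z) v)))) (at z)"
    by (rule has_derivative_transform_within_open[OF _ collar_open]) (use assms in \<open>auto simp: delta_eq\<close>)
  from fun_cong[OF frechet_derivative_at[OF this], of v] show ?thesis by simp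
qed

text \<open>One formula through \<open>\<delta>\<close> serves on all of \<Omega>: in the collar it
  is the chain rule, and off the collar, where \<open>\<delta>\<close> is unrelated to the distance,
  the next derivative of the step is 0 and annihilates the other factor.\<close>

lemma cutoff_deriv_has_derivative:
  assumes "z \<in> \<Omega>" "s > 0" "2 * s < s0"
  shows "((\<lambda>z. complex_of_real (smooth_step_deriv n (infdist z (frontier \<Omega>) / s))) has_derivative
    (\<lambda>v. of_real (smooth_step_deriv (Suc n) (infdist z (frontier \<Omega>) / s)) * (frechet_derivative \<delta> (at z) v * of_real (1 / s)))) (at z)"
proof (cases "infdist z (frontier \<Omega>) < s0")
  case True
  have "((\<lambda>z. infdist z (frontier \<Omega>) / s) has_derivative (\<lambda>v. Re (frechet_derivative \<delta> (at z) v) / s)) (at z)"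
    using infdist_has_derivative_collar[OF assms(1) True] by (rule bounded_linear.has_derivative[OF bounded_linear_divide])
  from has_derivative_of_real[OF has_derivative_compose[OF this smooth_step_deriv_has_derivative[unfolded has_field_derivative_def]]]
  show ?thesis
    by (rule has_derivative_eq_rhs) (subst delta_derivative_collar[OF assms(1) True], auto)
next
  case False
  \<comment> \<open>Because \<open>2 * s < s0\<close>, this open set contains every point outside
    the collar; on it the step and its derivatives are constant.\<close>
  let ?S = "{z. infdist z (frontier \<Omega>) > 2 * s}"
  have S: "open ?S" "z \<in> ?S" using False assms by (auto intro!: open_Collect_less continuous_intros)
  have eq: "smooth_step_deriv m (infdist y (frontier \<Omega>) / s) = (if m = 0 then 1 else 0)" if "y \<in> ?S" for m y
    using that assms by (intro smooth_step_deriv_beyond_2) (simp add: field_simps)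
  have "((\<lambda>_. complex_of_real (if n = 0 then 1 else 0)) has_derivative (\<lambda>_. 0)) (at z)" by simp
  then have "((\<lambda>z. complex_of_real (smooth_step_deriv n (infdist z (frontier \<Omega>) / s))) has_derivative (\<lambda>_. 0)) (at z)"
    by (rule has_derivative_transform_within_open[OF _ S]) (simp only: eq)
  then show ?thesis using eq[OF S(2), of "Suc n"] by simp
qed

text \<open>The generators are the smooth functions and all derivatives of the step at the scaled
  distance; differentiating one of the latter raises its order and produces a smooth factor from
  \<open>\<delta>\<close>.\<close>

lemma smooth_cutoff:
  assumes "s > 0" "2 * s < s0"
  shows "smooth_up_to_boundary \<Omega> (cutoff \<Omega> s)"
proof -
  let ?k = "\<lambda>n z. complex_of_real (smooth_step_deriv n (infdist z (frontier \<Omega>) / s))"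
  let ?A = "\<lambda>f. smooth_up_to_boundary \<Omega> f \<or> (\<exists>n. f = ?k n)"
  show ?thesis
  proof (rule smooth_up_to_boundary_alg_hull[OF \<Omega>(1), of ?A])
    have "cutoff \<Omega> s = ?k 0" by (auto simp: cutoff_def)
    then show "alg_hull ?A (cutoff \<Omega> s)" by (intro alg_hull.base) blast
    show "f differentiable (at x)" if "?A f" "x \<in> \<Omega>" for f x
      using that(1)
    proof
      assume "smooth_up_to_boundary \<Omega> f"
      then show ?thesis using that(2) by (rule smooth_up_to_boundary_differentiable)
    next
      assume "\<exists>n. f = ?k n"
      then obtain n where "f = ?k n" by blast
      then show ?thesis
        using cutoff_deriv_has_derivative[OF that(2) assms, of n] by (auto simp only: differentiable_def)
    qed
    show "\<exists>F. continuous_on (closure \<Omega>) F \<and> (\<forall>x\<in>\<Omega>. F x = f x)" if "?A f" for f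
      using that
    proof
      assume "smooth_up_to_boundary \<Omega> f"
      then show ?thesis using smooth_up_to_boundary_extension by metis
    next
      assume "\<exists>n. f = ?k n"
      then obtain n where f: "f = ?k n" by blast
      have "continuous_on (closure \<Omega>) (?k n)"
        using assms
        by (intro continuous_intros continuous_on_compose2[OF continuous_on_smooth_step_deriv[of UNIV]]) auto
      then show ?thesis unfolding f by blast
    qed
    show "\<exists>g. alg_hull ?A g \<and> (\<forall>x\<in>\<Omega>. frechet_derivative f (at x) v = g x)" if "?A f" for f v
      using that
    proof
      assume "smooth_up_to_boundary \<Omega> f"
      then have "alg_hull ?A (\<lambda>x. frechet_derivative f (at x) v)"
        by (intro alg_hull.base disjI1 smooth_up_to_boundary_frechet_derivative)
      then show ?thesis by auto
    next
      assume "\<exists>n. f = ?k n"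
      then obtain n where f: "f = ?k n" by blast
      have "frechet_derivative f (at x) v = ?k (Suc n) x * (frechet_derivative \<delta> (at x) v * of_real (1 / s))"
        if "x \<in> \<Omega>" for x
        unfolding f by (rule frechet_derivative_at[OF cutoff_deriv_has_derivative[OF that assms], THEN fun_cong, symmetric])
      moreover have "alg_hull ?A (\<lambda>x. ?k (Suc n) x * (frechet_derivative \<delta> (at x) v * of_real (1 / s)))"
        by (rule alg_hull.mult[OF alg_hull.base alg_hull.mult[OF alg_hull.base alg_hull.const]])
          (intro disjI2 exI[of _ "Suc n"] refl,
            intro disjI1 smooth_up_to_boundary_frechet_derivative delta)
      ultimately show ?thesis by blast
    qed
  qed
qed

lemma dbar_cutoff:
  assumes "z \<in> \<Omega>" "s > 0" "2 * s < s0"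
  shows "dbar e f (cutoff \<Omega> s) z = of_real (smooth_step_deriv 1 (infdist z (frontier \<Omega>) / s) / s) * dbar e f \<delta> z"
proof -
  have c: "cutoff \<Omega> s = (\<lambda>z. complex_of_real (smooth_step_deriv 0 (infdist z (frontier \<Omega>) / s)))"
    by (auto simp: cutoff_def)
  have alg: "(of_real a * (x * of_real (1 / s)) + \<i> * (of_real a * (y * of_real (1 / s)))) / 2
      = of_real (a / s) * ((x + \<i> * y) / 2)" for a x y
    by (simp add: distrib_left add_divide_distrib)
  note dbar_eqI[OF cutoff_deriv_has_derivative[OF assms, of 0], of e f]
  also note alg
  finally show ?thesis unfolding c by (simp only: dbar_def One_nat_def)
qed

end

section \<open>The distance to the boundary\<close>

lemma infdist_eq_dist_closest:
  fixes A :: "'a::euclidean_space set"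
  assumes "closed A" "A \<noteq> {}"
  obtains p where "p \<in> A" "infdist z A = dist z p"
proof -
  obtain p where p: "p \<in> A" "\<And>y. y \<in> A \<Longrightarrow> dist z p \<le> dist z y"
    using distance_attains_inf[OF assms, of z] by blast
  have "dist z p \<le> infdist z A"
    unfolding infdist_notempty[OF assms(2)] by (rule cINF_greatest[OF assms(2) p(2)])
  then show ?thesis using that[OF p(1)] infdist_le[OF p(1), of z] by simp
qed

text \<open>The gradient has length at most 1 because the distance is 1-Lipschitz, and at least 1
  because moving straight towards a nearest point of \<open>A\<close> decreases the distance at unit
  speed.\<close>

lemma infdist_sum_derivative_squares:
  fixes A :: "'a::euclidean_space set"
  assumes "closed A" "A \<noteq> {}" "z \<notin> A"
    and D: "((\<lambda>z. infdist z A) has_derivative D) (at z)"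
  shows "(\<Sum>b\<in>Basis. (D b)\<^sup>2) = 1"
proof -
  let ?d = "\<lambda>z. infdist z A"
  have D_eq: "D = frechet_derivative ?d (at z)" by (rule frechet_derivative_at[OF D])
  have dif: "?d differentiable (at z)" using D unfolding differentiable_def by blast
  have lip: "1-lipschitz_on UNIV ?d"
    by (rule lipschitz_onI) (use infdist_triangle_abs in \<open>auto simp: dist_real_def\<close>)
  define g where "g = (\<Sum>b\<in>Basis. D b *\<^sub>R b)"
  have Dg: "D v = g \<bullet> v" for v
  proof -
    have lin: "linear D" using D by (rule has_derivative_linear)
    have "D v = D (\<Sum>b\<in>Basis. (v \<bullet> b) *\<^sub>R b)" by (simp add: euclidean_representation)
    also have "\<dots> = (\<Sum>b\<in>Basis. (v \<bullet> b) * D b)" by (simp add: linear_sum[OF lin] linear_cmul[OF lin])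
    also have "\<dots> = g \<bullet> v" by (simp add: g_def inner_sum_left inner_commute[of v] mult.commute)
    finally show ?thesis .
  qed
  have "norm (D g) \<le> 1 * norm g"
    unfolding D_eq by (rule norm_frechet_derivative_le[OF lip dif])
  then have "(norm g)\<^sup>2 \<le> norm g" by (simp add: Dg dot_square_norm)
  then have le: "norm g \<le> 1"
    by (cases "g = 0") (auto simp: power2_eq_square)
  obtain p where p: "p \<in> A" "?d z = dist z p" using infdist_eq_dist_closest[OF assms(1,2)] by blast
  have d_pos: "?d z > 0" using p assms(3) by auto
  define u where "u = (p - z) /\<^sub>R ?d z"
  have p_eq: "p = z + ?d z *\<^sub>R u" using d_pos by (simp add: u_def)
  have u: "norm u = 1" using p d_pos by (simp add: u_def dist_norm norm_minus_commute)
  \<comment> \<open>These quotients follow the segment from \<open>z\<close> to the nearest point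
    \<open>p\<close>; they are at most -1 once the increment is shorter than the segment.\<close>
  have "(\<lambda>n. real (Suc n) *\<^sub>R (?d (u /\<^sub>R real (Suc n) + z) - ?d z)) \<longlonglongrightarrow> D u"
    unfolding D_eq by (rule frechet_derivative_LIMSEQ[OF dif])
  moreover have "\<forall>\<^sub>F n in sequentially. real (Suc n) *\<^sub>R (?d (u /\<^sub>R real (Suc n) + z) - ?d z) \<le> - 1"
  proof -
    have "\<forall>\<^sub>F n in sequentially. inverse (real (Suc n)) < ?d z"
      by (rule order_tendstoD(2)[OF LIMSEQ_inverse_real_of_nat d_pos])
    then show ?thesis
    proof eventually_elim
      case (elim n)
      let ?t = "inverse (real (Suc n))"
      have "?d (u /\<^sub>R real (Suc n) + z) \<le> dist (?t *\<^sub>R u + z) p"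
        by (rule infdist_le[OF p(1)])
      moreover have "?t *\<^sub>R u + z - p = - ((?d z - ?t) *\<^sub>R u)"
        by (subst p_eq) (simp add: scaleR_diff_left)
      then have "dist (?t *\<^sub>R u + z) p = \<bar>?d z - ?t\<bar> * norm u"
        by (simp only: dist_norm norm_minus_cancel norm_scaleR)
      moreover have "\<dots> = ?d z - ?t" using elim u by simp
      ultimately have "?d (u /\<^sub>R real (Suc n) + z) - ?d z \<le> - ?t" by simp
      then have "real (Suc n) * (?d (u /\<^sub>R real (Suc n) + z) - ?d z) \<le> real (Suc n) * - ?t"
        by (rule mult_left_mono) simp
      then show ?case by (simp del: of_nat_Suc)
    qed
  qed
  ultimately have "D u \<le> - 1"
    by (rule tendsto_upperbound) simp
  then have "1 \<le> \<bar>g \<bullet> u\<bar>" unfolding Dg by simp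
  also have "\<dots> \<le> norm g * norm u" by (rule Cauchy_Schwarz_ineq2)
  finally have "norm g = 1" using u le by simp
  moreover have "g \<bullet> g = (\<Sum>b\<in>Basis. (D b)\<^sup>2)"
    by (subst euclidean_inner) (simp add: Dg power2_eq_square)
  ultimately show ?thesis by (simp add: dot_square_norm)
qed

lemma sum_Basis_complex_vec:
  fixes f :: "complex ^ 'n \<Rightarrow> 'b::comm_monoid_add"
  shows "sum f Basis = (\<Sum>j\<in>UNIV. f (axis j 1) + f (axis j \<i>))"
proof -
  have B: "(Basis :: (complex ^ 'n) set) = (\<Union>j\<in>UNIV. {axis j 1, axis j \<i>})"
    by (auto simp: Basis_vec_def Basis_complex_def)
  show ?thesis unfolding B
    by (subst sum.UNION_disjoint) (auto simp: axis_eq_axis)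
qed

section \<open>The gradient identity in complex coordinates and integration by parts up to the
  boundary\<close>

context
  fixes \<Omega> :: "(complex ^ 'n) set" and \<delta> :: "complex ^ 'n \<Rightarrow> complex" and s0 :: real
  assumes \<Omega>: "open \<Omega>" "bounded \<Omega>" and delta: "smooth_up_to_boundary \<Omega> \<delta>" and s0: "s0 > 0"
    and delta_eq: "\<And>z. z \<in> \<Omega> \<Longrightarrow> infdist z (frontier \<Omega>) < s0 \<Longrightarrow> \<delta> z = of_real (infdist z (frontier \<Omega>))"
    and frontier_ne: "frontier \<Omega> \<noteq> {}"
begin

lemma infdist_frontier_pos: "z \<in> \<Omega> \<Longrightarrow> infdist z (frontier \<Omega>) > 0"
  using infdist_pos_not_in_closed[OF frontier_closed frontier_ne, of z] \<Omega>(1)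
  by (auto simp: frontier_def interior_open)

text \<open>As the derivatives of \<open>\<delta>\<close> are real here, each summand is the sum of
  the squares of the two real partial derivatives in the \<open>j\<close>-th coordinate plane, and
  these add up to the squared gradient of the distance.\<close>

lemma dbar_delta_collar:
  assumes "z \<in> \<Omega>" "infdist z (frontier \<Omega>) < s0"
  shows "(\<Sum>j\<in>UNIV. 2 * (frechet_derivative \<delta> (at z) (axis j 1) - \<i> * frechet_derivative \<delta> (at z) (axis j \<i>))
    * dbar (axis j 1) (axis j \<i>) \<delta> z) = 1"
proof -
  let ?D = "\<lambda>v. Re (frechet_derivative \<delta> (at z) v)"
  have z: "z \<notin> frontier \<Omega>" using infdist_frontier_pos[OF assms(1)] by auto
  have "(\<Sum>b\<in>Basis. (?D b)\<^sup>2) = 1"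
    by (rule infdist_sum_derivative_squares[OF frontier_closed frontier_ne z
          infdist_has_derivative_collar[OF \<Omega> delta s0 delta_eq assms]])
  then have "(\<Sum>j\<in>UNIV. (?D (axis j 1))\<^sup>2 + (?D (axis j \<i>))\<^sup>2) = 1"
    by (simp add: sum_Basis_complex_vec)
  then have "of_real (\<Sum>j\<in>UNIV. (?D (axis j 1))\<^sup>2 + (?D (axis j \<i>))\<^sup>2) = (1::complex)" by simp
  moreover have "2 * (frechet_derivative \<delta> (at z) (axis j 1) - \<i> * frechet_derivative \<delta> (at z) (axis j \<i>))
    * dbar (axis j 1) (axis j \<i>) \<delta> z = of_real ((?D (axis j 1))\<^sup>2 + (?D (axis j \<i>))\<^sup>2)" for j
  proof -
    have "(a - \<i> * b) * (a + \<i> * b) = a\<^sup>2 + b\<^sup>2" for a b :: complex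
      by (simp add: algebra_simps power2_eq_square)
    moreover have "2 * x * (y / 2) = x * y" for x y :: complex by simp
    ultimately have alg: "2 * (a - \<i> * b) * ((a + \<i> * b) / 2) = a\<^sup>2 + b\<^sup>2" for a b :: complex
      by (simp only:)
    show ?thesis
      unfolding dbar_def alg of_real_add of_real_power
      by (simp only: delta_derivative_collar[OF \<Omega> delta s0 delta_eq assms, symmetric])
  qed
  ultimately show ?thesis by simp
qed

text \<open>Since \<open>\<Psi>\<close> vanishes on the boundary, \<open>\<Psi>\<close> times the gradient of the cutoff at scale \<open>s\<close> stays
  bounded as \<open>s\<close> tends to 0, so integrability of \<open>\<eta>\<close> suffices to pass to the limit.\<close>

lemma integral_holomorphic_dbar_vanishing:
  assumes int: "set_integrable lborel \<Omega> \<eta>" and hol: "holomorphic_on_vec \<eta> \<Omega>"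
    and \<Psi>: "smooth_up_to_boundary \<Omega> \<Psi>"
    and C: "\<And>z. z \<in> \<Omega> \<Longrightarrow> infdist z (frontier \<Omega>) < s0 \<Longrightarrow> norm (\<Psi> z) \<le> C * infdist z (frontier \<Omega>)"
  shows "(LINT z:\<Omega>|lborel. \<eta> z * dbar e (\<i> *s e) \<Psi> z) = 0"
proof -
  let ?d = "\<lambda>z. infdist z (frontier \<Omega>)" and ?db = "dbar e (\<i> *s e)"
  \<comment> \<open>The factor \<open>s0 / 3\<close> gives \<open>2 * s n < s0\<close> already for
    \<open>n = 0\<close>, so every cutoff in the sequence is smooth.\<close>
  define s where "s = (\<lambda>n. (s0 / 3) * inverse (real (Suc n)))"
  have s: "s n > 0" "2 * s n < s0" for n
  proof -
    show "s n > 0" using s0 by (simp add: s_def)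
    have "s n \<le> (s0 / 3) * 1"
      unfolding s_def using s0 by (intro mult_left_mono) (simp_all add: inverse_le_1_iff)
    then show "2 * s n < s0" using s0 by simp
  qed
  have "(\<lambda>n. (s0 / 3) * inverse (real (Suc n))) \<longlonglongrightarrow> (s0 / 3) * 0"
    by (intro tendsto_mult tendsto_const LIMSEQ_inverse_real_of_nat)
  then have s_lim: "s \<longlonglongrightarrow> 0" by (simp add: s_def)
  define G where "G = (\<lambda>n z. \<Psi> z * cutoff \<Omega> (s n) z)"
  have cut: "smooth_up_to_boundary \<Omega> (cutoff \<Omega> (s n))" for n
    by (rule smooth_cutoff[OF \<Omega> delta s0 delta_eq s])
  have smG: "smooth_up_to_boundary \<Omega> (G n)" for n
    unfolding G_def by (rule smooth_up_to_boundary_mult[OF \<Omega>(1) \<Psi> cut])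
  have zero: "(LINT z:\<Omega>|lborel. \<eta> z * ?db (G n) z) = 0" for n
    by (rule integral_holomorphic_dbar_compact_support[OF \<Omega> hol smG s(1)[of n]])
      (simp add: G_def cutoff_eq_0 s)
  have dG: "?db (G n) z = \<Psi> z * (of_real (smooth_step_deriv 1 (?d z / s n) / s n) * ?db \<delta> z)
      + ?db \<Psi> z * cutoff \<Omega> (s n) z" if "z \<in> \<Omega>" for n z
    unfolding G_def
    by (subst dbar_mult[OF smooth_up_to_boundary_differentiable[OF \<Psi> that] smooth_up_to_boundary_differentiable[OF cut that]])
      (simp only: dbar_cutoff[OF \<Omega> delta s0 delta_eq that s])
  obtain B0 where B0: "B0 > 0" "\<And>t. t \<ge> 0 \<Longrightarrow> \<bar>smooth_step_deriv 0 t\<bar> \<le> B0"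
    using smooth_step_deriv_bounded[of 0] by blast
  obtain B1 where B1: "B1 > 0" "\<And>t. t \<ge> 0 \<Longrightarrow> \<bar>smooth_step_deriv 1 t\<bar> \<le> B1"
    using smooth_step_deriv_bounded[of 1] by blast
  obtain M1 where M1: "M1 > 0" "\<And>z. z \<in> \<Omega> \<Longrightarrow> norm (?db \<delta> z) \<le> M1"
    using smooth_up_to_boundary_bounded[OF \<Omega>(2) smooth_dbar[OF \<Omega>(1) delta]] by blast
  obtain M2 where M2: "M2 > 0" "\<And>z. z \<in> \<Omega> \<Longrightarrow> norm (?db \<Psi> z) \<le> M2"
    using smooth_up_to_boundary_bounded[OF \<Omega>(2) smooth_dbar[OF \<Omega>(1) \<Psi>]] by blast
  \<comment> \<open>First summand: where the step varies, \<open>\<Psi>\<close> is at most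
    \<open>\<bar>C\<bar> * 2 * s n\<close>, against a derivative of the cutoff of size
    \<open>B1 * M1 / s n\<close>. Second summand: the cutoff times the derivative of
    \<open>\<Psi>\<close>.\<close>
  define C' where "C' = \<bar>C\<bar> * 2 * B1 * M1 + M2 * B0"
  have bound: "norm (?db (G n) z) \<le> C'" if z: "z \<in> \<Omega>" for n z
  proof -
    have 2: "norm (?db \<Psi> z * cutoff \<Omega> (s n) z) \<le> M2 * B0"
      unfolding norm_mult cutoff_def
      using M2(1) M2(2)[OF z] B0(2)[of "?d z / s n"] s(1)[of n] infdist_nonneg[of z "frontier \<Omega>"]
      by (intro mult_mono) auto
    have 1: "norm (\<Psi> z * (of_real (smooth_step_deriv 1 (?d z / s n) / s n) * ?db \<delta> z)) \<le> \<bar>C\<bar> * 2 * B1 * M1"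
    proof (cases "?d z \<le> 2 * s n")
      case True
      have "norm (\<Psi> z) \<le> C * ?d z" using True s(2)[of n] by (intro C z) linarith
      also have "\<dots> \<le> \<bar>C\<bar> * (2 * s n)" using True by (intro mult_mono infdist_nonneg) auto
      finally have "norm (\<Psi> z) * (B1 / s n * M1) \<le> \<bar>C\<bar> * (2 * s n) * (B1 / s n * M1)"
        using B1(1) M1(1) s(1)[of n] by (intro mult_right_mono) auto
      also have "\<dots> = \<bar>C\<bar> * 2 * B1 * M1" using s(1)[of n] by simp
      finally have *: "norm (\<Psi> z) * (B1 / s n * M1) \<le> \<bar>C\<bar> * 2 * B1 * M1" .
      have "\<bar>smooth_step_deriv 1 (?d z / s n)\<bar> / s n \<le> B1 / s n"
        using B1(2)[of "?d z / s n"] s(1)[of n] infdist_nonneg[of z "frontier \<Omega>"] by (intro divide_right_mono) auto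
      then have "norm (complex_of_real (smooth_step_deriv 1 (?d z / s n) / s n)) * norm (?db \<delta> z) \<le> B1 / s n * M1"
        using M1(1) M1(2)[OF z] B1(1) s(1)[of n] by (intro mult_mono) (simp_all only: norm_of_real abs_divide abs_of_pos norm_ge_zero divide_nonneg_pos less_imp_le)
      then have "norm (\<Psi> z) * (norm (complex_of_real (smooth_step_deriv 1 (?d z / s n) / s n)) * norm (?db \<delta> z))
          \<le> norm (\<Psi> z) * (B1 / s n * M1)" by (intro mult_left_mono) auto
      then show ?thesis unfolding norm_mult using * by (rule order_trans)
    next
      case False
      then have "?d z / s n > 2" using s(1)[of n] by (simp add: field_simps)
      then have "smooth_step_deriv 1 (?d z / s n) = 0" by (subst smooth_step_deriv_beyond_2) simp_all
      then have "\<Psi> z * (of_real (smooth_step_deriv 1 (?d z / s n) / s n) * ?db \<delta> z) = 0"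
        by (simp only: div_0 of_real_0 mult_zero_left mult_zero_right)
      then show ?thesis using B1(1) M1(1) by (simp only: norm_zero) simp
    qed
    show ?thesis unfolding dG[OF z] C'_def
      by (rule order_trans[OF norm_triangle_ineq add_mono[OF 1 2]])
  qed
  \<comment> \<open>A fixed \<open>z\<close> has positive distance to the frontier, so the cutoffs
    are eventually 1 around it and the sequence is eventually constant.\<close>
  have lim: "(\<lambda>n. ?db (G n) z) \<longlonglongrightarrow> ?db \<Psi> z" if z: "z \<in> \<Omega>" for z
  proof (rule tendsto_eventually)
    have "\<forall>\<^sub>F n in sequentially. s n < ?d z / 2"
      using infdist_frontier_pos[OF z] by (intro order_tendstoD(2)[OF s_lim]) simp
    then show "\<forall>\<^sub>F n in sequentially. ?db (G n) z = ?db \<Psi> z"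
    proof eventually_elim
      case (elim n)
      then have "?d z / s n > 2" using s(1)[of n] by (simp add: field_simps)
      then have "smooth_step_deriv 1 (?d z / s n) = 0" by (subst smooth_step_deriv_beyond_2) simp_all
      moreover have "cutoff \<Omega> (s n) z = 1" using elim by (intro cutoff_eq_1 s) simp
      ultimately show ?case
        by (simp only: dG[OF z] div_0 of_real_0 mult_zero_left mult_zero_right add_0_left mult_1_right)
    qed
  qed
  have cont: "continuous_on \<Omega> (?db f)" if "smooth_up_to_boundary \<Omega> f" for f
    by (rule smooth_up_to_boundary_continuous_on[OF smooth_dbar[OF \<Omega>(1) that]])
  have "(\<lambda>n. LINT z|lborel. indicator \<Omega> z *\<^sub>R (\<eta> z * ?db (G n) z))
      \<longlonglongrightarrow> (LINT z|lborel. indicator \<Omega> z *\<^sub>R (\<eta> z * ?db \<Psi> z))"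
  proof (rule integral_dominated_convergence[where w = "\<lambda>z. C' * norm (indicator \<Omega> z *\<^sub>R \<eta> z)"])
    show "integrable lborel (\<lambda>z. C' * norm (indicator \<Omega> z *\<^sub>R \<eta> z))"
      using int unfolding set_integrable_def by (intro integrable_mult_right integrable_norm)
    show "AE z in lborel. norm (indicator \<Omega> z *\<^sub>R (\<eta> z * ?db (G n) z)) \<le> C' * norm (indicator \<Omega> z *\<^sub>R \<eta> z)" for n
      using bound[of _ n]
      by (intro AE_I2) (auto simp: indicator_def norm_mult mult.commute[of C'] intro!: mult_left_mono)
    show "AE z in lborel. (\<lambda>n. indicator \<Omega> z *\<^sub>R (\<eta> z * ?db (G n) z)) \<longlonglongrightarrow> indicator \<Omega> z *\<^sub>R (\<eta> z * ?db \<Psi> z)"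
    proof (intro AE_I2)
      fix z
      show "(\<lambda>n. indicator \<Omega> z *\<^sub>R (\<eta> z * ?db (G n) z)) \<longlonglongrightarrow> indicator \<Omega> z *\<^sub>R (\<eta> z * ?db \<Psi> z)"
        by (cases "z \<in> \<Omega>") (auto intro!: tendsto_intros lim)
    qed
  qed (intro measurable_indicator_mult \<Omega>(1) int cont \<Psi> smG)+
  then show ?thesis
    using zero by (simp add: set_lebesgue_integral_def LIMSEQ_const_iff)
qed

end

section \<open>Moving densities towards the boundary\<close>

lemma dbar_power:
  assumes "f differentiable (at x)"
  shows "dbar u v (\<lambda>x. f x ^ Suc m) x = of_nat (Suc m) * f x ^ m * dbar u v f x"
proof (induction m)
  case (Suc m)
  have "dbar u v (\<lambda>x. f x * f x ^ Suc m) x = f x * dbar u v (\<lambda>x. f x ^ Suc m) x + dbar u v f x * f x ^ Suc m"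
    by (rule dbar_mult[OF assms]) (use assms in simp)
  then show ?case unfolding Suc.IH by (simp add: algebra_simps)
qed simp

lemma i_times_axis: "\<i> *s axis j 1 = (axis j \<i> :: complex ^ 'n)"
  by (simp add: vec_eq_iff axis_def)

lemma norm_axis_complex_1: "norm (axis j (1::complex)) = 1"
  by (simp add: norm_eq_sqrt_inner inner_axis_axis)

context
  fixes \<Omega> :: "(complex ^ 'n) set" and \<delta> :: "complex ^ 'n \<Rightarrow> complex" and s0 :: real
  assumes \<Omega>: "open \<Omega>" "bounded \<Omega>" and delta: "smooth_up_to_boundary \<Omega> \<delta>" and s0: "s0 > 0"
    and delta_eq: "\<And>z. z \<in> \<Omega> \<Longrightarrow> infdist z (frontier \<Omega>) < s0 \<Longrightarrow> \<delta> z = of_real (infdist z (frontier \<Omega>))"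
    and frontier_ne: "frontier \<Omega> \<noteq> {}"
begin

lemma open_deep: "open {z \<in> \<Omega>. infdist z (frontier \<Omega>) > t}"
  using open_Int[OF \<Omega>(1) open_Collect_less[of "\<lambda>_. t" "\<lambda>z. infdist z (frontier \<Omega>)"]]
  by (simp add: continuous_intros Int_def)

text \<open>\<open>\<delta>\<close> may vanish inside \<open>\<Omega>\<close>, so the part of \<open>g\<close> away from the boundary cannot be divided by a power
  of \<open>\<delta>\<close>.\<close>

lemma push_to_collar:
  assumes g: "smooth_up_to_boundary \<Omega> g" and s: "s > 0" "2 * s < s0"
  obtains h where "smooth_up_to_boundary \<Omega> h"
    "\<And>z. z \<in> \<Omega> \<Longrightarrow> infdist z (frontier \<Omega>) > 2 * s \<Longrightarrow> h z = 0"
    "\<And>\<eta>. set_integrable lborel \<Omega> \<eta> \<Longrightarrow> holomorphic_on_vec \<eta> \<Omega> \<Longrightarrow>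
      (LINT z:\<Omega>|lborel. \<eta> z * g z) = (LINT z:\<Omega>|lborel. \<eta> z * h z)"
proof -
  \<comment> \<open>Any coordinate direction serves; \<open>undefined\<close> picks one from the
    index type, which is nonempty.\<close>
  define e :: "complex ^ 'n" where "e = axis undefined 1"
  define \<iota> where "\<iota> = (\<lambda>w. w *s e)"
  have lin: "linear \<iota>"
    unfolding \<iota>_def by (rule linearI) (simp_all add: vec_eq_iff distrib_right)
  have norm: "norm (\<iota> w) = norm w" for w
    by (simp add: \<iota>_def e_def norm_vector_scalar_mult norm_axis_complex_1)
  let ?k = "cutoff \<Omega> s" and ?c = "LINT w|lborel. bump w" and ?db = "dbar e (\<i> *s e)"
  \<comment> \<open>The cutoff makes the extension by zero smooth on the whole space, as the Cauchy
    transform requires: it integrates along entire complex lines.\<close>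
  define f where "f = (\<lambda>z. if z \<in> \<Omega> then ?k z * g z else 0)"
  have k: "smooth_up_to_boundary \<Omega> ?k" by (rule smooth_cutoff[OF \<Omega> delta s0 delta_eq s])
  have f: "smooth_up_to_boundary UNIV f"
    unfolding f_def
    by (rule smooth_extend_by_zero[OF \<Omega>(1) smooth_up_to_boundary_mult[OF \<Omega>(1) k g] s(1)])
      (simp add: cutoff_eq_0[OF s(1)])
  obtain R where R: "\<forall>x\<in>\<Omega>. norm x \<le> R" using \<Omega>(2) unfolding bounded_iff by blast
  have suppf: "f z = 0" if "norm z > R" for z using that R by (auto simp: f_def)
  \<comment> \<open>Dividing by the integral of \<open>bump\<close> normalises the transform to an
    exact solution.\<close>
  define \<phi> where "\<phi> = (\<lambda>z. cauchy_transform \<iota> f z * of_real (1 / ?c))"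
  have T: "smooth_up_to_boundary \<Omega> (cauchy_transform \<iota> f)"
    by (rule smooth_cauchy_transform[OF lin norm f suppf \<Omega>(1)])
  have \<phi>: "smooth_up_to_boundary \<Omega> \<phi>"
    unfolding \<phi>_def by (intro smooth_up_to_boundary_mult smooth_up_to_boundary_const \<Omega>(1) T)
  have db\<phi>: "?db \<phi> z = f z" if "z \<in> \<Omega>" for z
  proof -
    have "?db (cauchy_transform \<iota> f) z = f z * ?c"
      using dbar_cauchy_transform[where z = z, OF lin norm f suppf] by (simp add: \<iota>_def)
    moreover have "?db \<phi> z = cauchy_transform \<iota> f z * ?db (\<lambda>_. of_real (1 / ?c)) z
        + ?db (cauchy_transform \<iota> f) z * of_real (1 / ?c)"
      unfolding \<phi>_def by (rule dbar_mult[OF smooth_up_to_boundary_differentiable[OF T that]]) simp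
    ultimately show ?thesis using integral_bump_pos by simp
  qed
  \<comment> \<open>The transform need not vanish near the frontier, so a second factor of the
    cutoff is required before integrating by parts. Deep inside \<Omega> both factors are 1 and the
    Cauchy-Riemann derivative of \<open>u\<close> is still \<open>g\<close>.\<close>
  define u where "u = (\<lambda>z. ?k z * \<phi> z)"
  have u: "smooth_up_to_boundary \<Omega> u"
    unfolding u_def by (rule smooth_up_to_boundary_mult[OF \<Omega>(1) k \<phi>])
  define h where "h = (\<lambda>z. g z - ?db u z)"
  show ?thesis
  proof (rule that)
    show "smooth_up_to_boundary \<Omega> h"
      unfolding h_def by (intro smooth_up_to_boundary_diff smooth_dbar \<Omega>(1) g u)
    show "h z = 0" if z: "z \<in> \<Omega>" "infdist z (frontier \<Omega>) > 2 * s" for z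
    proof -
      have k1: "?k y = 1" if "y \<in> {z \<in> \<Omega>. infdist z (frontier \<Omega>) > 2 * s}" for y
        using that by (intro cutoff_eq_1 s) simp
      have "?db u z = ?db \<phi> z"
        by (rule dbar_cong_open[OF open_deep[of "2 * s"]]) (use z k1 in \<open>simp_all add: u_def\<close>)
      also have "\<dots> = g z" using db\<phi>[OF z(1)] k1[of z] z by (simp add: f_def)
      finally show ?thesis by (simp add: h_def)
    qed
    fix \<eta> assume \<eta>: "set_integrable lborel \<Omega> \<eta>" "holomorphic_on_vec \<eta> \<Omega>"
    have "(LINT z:\<Omega>|lborel. \<eta> z * ?db u z) = 0"
      by (rule integral_holomorphic_dbar_compact_support[OF \<Omega> \<eta>(2) u s(1)])
        (simp add: u_def cutoff_eq_0[OF s(1)])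
    moreover have "(LINT z:\<Omega>|lborel. \<eta> z * h z) = (LINT z:\<Omega>|lborel. \<eta> z * g z) - (LINT z:\<Omega>|lborel. \<eta> z * ?db u z)"
      unfolding h_def right_diff_distrib
      by (intro set_integral_diff(2) set_integrable_mult_smooth \<Omega> \<eta>(1) g smooth_dbar u)
    ultimately show "(LINT z:\<Omega>|lborel. \<eta> z * g z) = (LINT z:\<Omega>|lborel. \<eta> z * h z)" by simp
  qed
qed

text \<open>The depth \<open>t\<close> is handed on unchanged, since differentiation does not
  enlarge supports; this is what permits iteration inside one collar.\<close>

lemma raise_power:
  assumes h: "smooth_up_to_boundary \<Omega> h" and t: "t < s0"
    and h0: "\<And>z. z \<in> \<Omega> \<Longrightarrow> infdist z (frontier \<Omega>) > t \<Longrightarrow> h z = 0"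
  obtains h' where "smooth_up_to_boundary \<Omega> h'"
    "\<And>z. z \<in> \<Omega> \<Longrightarrow> infdist z (frontier \<Omega>) > t \<Longrightarrow> h' z = 0"
    "\<And>\<eta>. set_integrable lborel \<Omega> \<eta> \<Longrightarrow> holomorphic_on_vec \<eta> \<Omega> \<Longrightarrow>
      (LINT z:\<Omega>|lborel. \<eta> z * (\<delta> z ^ m * h z)) = (LINT z:\<Omega>|lborel. \<eta> z * (\<delta> z ^ Suc m * h' z))"
proof -
  let ?db = "\<lambda>j. dbar (axis j 1) (axis j \<i>)"
  define \<phi> where "\<phi> = (\<lambda>j z. 2 * (frechet_derivative \<delta> (at z) (axis j 1) - \<i> * frechet_derivative \<delta> (at z) (axis j \<i>)))"
  have \<phi>: "smooth_up_to_boundary \<Omega> (\<phi> j)" for j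
    unfolding \<phi>_def
    by (intro smooth_up_to_boundary_mult smooth_up_to_boundary_diff smooth_up_to_boundary_const
        smooth_up_to_boundary_frechet_derivative delta \<Omega>(1))
  define q where "q = (\<lambda>j z. \<phi> j z * h z)"
  have q: "smooth_up_to_boundary \<Omega> (q j)" for j
    unfolding q_def by (rule smooth_up_to_boundary_mult[OF \<Omega>(1) \<phi> h])
  \<comment> \<open>The factor \<open>1 / Suc m\<close> undoes the derivative of
    \<open>\<delta> ^ Suc m\<close>; the minus sign comes from moving the derivative onto
    \<open>q j\<close>.\<close>
  define h' where "h' = (\<lambda>z. (- 1 / of_nat (Suc m)) * (\<Sum>j\<in>UNIV. ?db j (q j) z))"
  have h': "smooth_up_to_boundary \<Omega> h'"
    unfolding h'_def
    by (intro smooth_up_to_boundary_mult smooth_up_to_boundary_sum smooth_up_to_boundary_const smooth_dbar q \<Omega>(1))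
  \<comment> \<open>The sum of the Cauchy-Riemann derivatives of the \<open>\<Psi> j\<close> is
    \<open>Suc m\<close> times the difference of the two densities, so the claim reduces to each of
    them integrating to zero against \<eta>.\<close>
  define \<Psi> where "\<Psi> = (\<lambda>j z. \<delta> z ^ Suc m * q j z)"
  have pow: "smooth_up_to_boundary \<Omega> (\<lambda>z. \<delta> z ^ n)" for n
    by (rule smooth_up_to_boundary_power[OF \<Omega>(1) delta])
  have \<Psi>: "smooth_up_to_boundary \<Omega> (\<Psi> j)" for j
    unfolding \<Psi>_def by (rule smooth_up_to_boundary_mult[OF \<Omega>(1) pow q])
  have sum_\<Psi>: "(\<Sum>j\<in>UNIV. ?db j (\<Psi> j) z) = of_nat (Suc m) * (\<delta> z ^ m * h z - \<delta> z ^ Suc m * h' z)"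
    if z: "z \<in> \<Omega>" for z
  proof -
    note dif = smooth_up_to_boundary_differentiable
    have "?db j (\<Psi> j) z = \<delta> z ^ Suc m * ?db j (q j) z + (of_nat (Suc m) * \<delta> z ^ m * ?db j \<delta> z) * q j z" for j
      unfolding \<Psi>_def
      by (subst dbar_mult[OF dif[OF pow z] dif[OF q z]], subst dbar_power[OF dif[OF delta z]], rule refl)
    then have "?db j (\<Psi> j) z = \<delta> z ^ Suc m * ?db j (q j) z + (of_nat (Suc m) * \<delta> z ^ m * h z) * (\<phi> j z * ?db j \<delta> z)" for j
      by (simp add: q_def mult_ac del: of_nat_Suc power_Suc)
    then have 1: "(\<Sum>j\<in>UNIV. ?db j (\<Psi> j) z) = \<delta> z ^ Suc m * (\<Sum>j\<in>UNIV. ?db j (q j) z)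
        + (of_nat (Suc m) * \<delta> z ^ m * h z) * (\<Sum>j\<in>UNIV. \<phi> j z * ?db j \<delta> z)"
      by (simp only: sum.distrib sum_distrib_left)
    \<comment> \<open>The gradient identity is available only in the collar; beyond depth
      \<open>t\<close> the factor \<open>h z\<close> is 0.\<close>
    have 2: "h z * (\<Sum>j\<in>UNIV. \<phi> j z * ?db j \<delta> z) = h z"
    proof (cases "infdist z (frontier \<Omega>) > t")
      case False
      then have "infdist z (frontier \<Omega>) < s0" using t by simp
      from dbar_delta_collar[OF \<Omega> delta s0 delta_eq frontier_ne z this]
      show ?thesis by (simp add: \<phi>_def)
    qed (simp add: h0[OF z])
    have 3: "(\<Sum>j\<in>UNIV. ?db j (q j) z) = - of_nat (Suc m) * h' z"
      unfolding h'_def by (simp del: of_nat_Suc)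
    have "(of_nat (Suc m) * \<delta> z ^ m * h z) * (\<Sum>j\<in>UNIV. \<phi> j z * ?db j \<delta> z) = of_nat (Suc m) * \<delta> z ^ m * h z"
      using 2 by (simp only: mult.assoc)
    then show ?thesis unfolding 1 3 by (simp add: right_diff_distrib mult_ac del: of_nat_Suc power_Suc)
  qed
  show ?thesis
  proof (rule that[OF h'])
    show "h' z = 0" if z: "z \<in> \<Omega>" "infdist z (frontier \<Omega>) > t" for z
    proof -
      have "?db j (q j) z = ?db j (\<lambda>_. 0) z" for j
        by (rule dbar_cong_open[OF open_deep[of t]]) (use z in \<open>simp_all add: q_def h0\<close>)
      then show ?thesis by (simp add: h'_def)
    qed
    fix \<eta> assume \<eta>: "set_integrable lborel \<Omega> \<eta>" "holomorphic_on_vec \<eta> \<Omega>"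
    have int: "set_integrable lborel \<Omega> (\<lambda>z. \<eta> z * f z)" if "smooth_up_to_boundary \<Omega> f" for f
      by (rule set_integrable_mult_smooth[OF \<Omega> \<eta>(1) that])
    have zero: "(LINT z:\<Omega>|lborel. \<eta> z * ?db j (\<Psi> j) z) = 0" for j
    proof -
      \<comment> \<open>One factor \<open>\<delta>\<close>, which is the distance in the collar, is
        split off and the rest is bounded; so \<open>\<Psi> j\<close> vanishes to first order even
        for \<open>m = 0\<close>.\<close>
      have "smooth_up_to_boundary \<Omega> (\<lambda>z. \<delta> z ^ m * q j z)"
        by (rule smooth_up_to_boundary_mult[OF \<Omega>(1) pow q])
      then obtain C where C: "C > 0" "\<And>z. z \<in> \<Omega> \<Longrightarrow> norm (\<delta> z ^ m * q j z) \<le> C"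
        using smooth_up_to_boundary_bounded[OF \<Omega>(2)] by blast
      have "(LINT z:\<Omega>|lborel. \<eta> z * dbar (axis j 1) (\<i> *s axis j 1) (\<Psi> j) z) = 0"
      proof (rule integral_holomorphic_dbar_vanishing[OF \<Omega> delta s0 delta_eq frontier_ne \<eta> \<Psi>])
        show "norm (\<Psi> j z) \<le> C * infdist z (frontier \<Omega>)"
          if z: "z \<in> \<Omega>" "infdist z (frontier \<Omega>) < s0" for z
        proof -
          have "\<Psi> j z = (\<delta> z ^ m * q j z) * \<delta> z" by (simp add: \<Psi>_def mult_ac)
          moreover have "norm (\<delta> z) = infdist z (frontier \<Omega>)"
            by (simp add: delta_eq[OF z] infdist_nonneg)
          ultimately show ?thesis
            using mult_right_mono[OF C(2)[OF z(1)] infdist_nonneg[of z "frontier \<Omega>"]] by (simp add: norm_mult)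
        qed
      qed
      then show ?thesis by (simp add: i_times_axis)
    qed
    have "(LINT z:\<Omega>|lborel. \<eta> z * (\<delta> z ^ m * h z)) - (LINT z:\<Omega>|lborel. \<eta> z * (\<delta> z ^ Suc m * h' z))
        = (LINT z:\<Omega>|lborel. \<eta> z * (\<delta> z ^ m * h z - \<delta> z ^ Suc m * h' z))"
      unfolding right_diff_distrib
      by (intro set_integral_diff(2)[symmetric] int smooth_up_to_boundary_mult pow h h' \<Omega>(1))
    also have "\<dots> = (LINT z:\<Omega>|lborel. (1 / of_nat (Suc m)) * (\<Sum>j\<in>UNIV. \<eta> z * ?db j (\<Psi> j) z))"
      by (rule set_lebesgue_integral_cong)
        (use \<Omega>(1) in \<open>auto simp: sum_\<Psi> simp flip: sum_distrib_left simp del: of_nat_Suc power_Suc\<close>)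
    also have "\<dots> = (1 / of_nat (Suc m)) * (LINT z:\<Omega>|lborel. (\<Sum>j\<in>UNIV. \<eta> z * ?db j (\<Psi> j) z))"
      by (rule set_integral_mult_right)
    also have "(LINT z:\<Omega>|lborel. (\<Sum>j\<in>UNIV. \<eta> z * ?db j (\<Psi> j) z)) = (\<Sum>j\<in>UNIV. (LINT z:\<Omega>|lborel. \<eta> z * ?db j (\<Psi> j) z))"
      unfolding set_lebesgue_integral_def scaleR_sum_right
      by (rule Bochner_Integration.integral_sum)
        (use int[OF smooth_dbar[OF \<Omega>(1) \<Psi>]] in \<open>simp add: set_integrable_def\<close>)
    also have "\<dots> = 0" by (simp only: zero sum.neutral_const)
    finally show "(LINT z:\<Omega>|lborel. \<eta> z * (\<delta> z ^ m * h z)) = (LINT z:\<Omega>|lborel. \<eta> z * (\<delta> z ^ Suc m * h' z))" by simp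
  qed
qed

text \<open>Vanishing off the collar belongs to the induction claim because every raising step
  consumes it. The depth \<open>2 * s0 / 3\<close> is twice the cutoff scale \<open>s0 / 3\<close>
  of the initial push and stays below \<open>s0\<close>.\<close>

lemma integral_eq_integral_delta_power:
  assumes g: "smooth_up_to_boundary \<Omega> g"
  shows "\<exists>h. smooth_up_to_boundary \<Omega> h \<and>
    (\<forall>z\<in>\<Omega>. infdist z (frontier \<Omega>) > 2 * s0 / 3 \<longrightarrow> h z = 0) \<and>
    (\<forall>\<eta>. set_integrable lborel \<Omega> \<eta> \<longrightarrow> holomorphic_on_vec \<eta> \<Omega> \<longrightarrow>
      (LINT z:\<Omega>|lborel. \<eta> z * g z) = (LINT z:\<Omega>|lborel. \<eta> z * (\<delta> z ^ k * h z)))"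
proof (induction k)
  case 0
  have "s0 / 3 > 0" "2 * (s0 / 3) < s0" using s0 by auto
  from push_to_collar[OF g this] obtain h where "smooth_up_to_boundary \<Omega> h"
    "\<And>z. z \<in> \<Omega> \<Longrightarrow> infdist z (frontier \<Omega>) > 2 * (s0 / 3) \<Longrightarrow> h z = 0"
    "\<And>\<eta>. set_integrable lborel \<Omega> \<eta> \<Longrightarrow> holomorphic_on_vec \<eta> \<Omega> \<Longrightarrow>
      (LINT z:\<Omega>|lborel. \<eta> z * g z) = (LINT z:\<Omega>|lborel. \<eta> z * h z)" by blast
  then show ?case by (intro exI[of _ h]) simp
next
  case (Suc k)
  then obtain h where h: "smooth_up_to_boundary \<Omega> h"
    "\<And>z. z \<in> \<Omega> \<Longrightarrow> infdist z (frontier \<Omega>) > 2 * s0 / 3 \<Longrightarrow> h z = 0"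
    "\<And>\<eta>. set_integrable lborel \<Omega> \<eta> \<Longrightarrow> holomorphic_on_vec \<eta> \<Omega> \<Longrightarrow>
      (LINT z:\<Omega>|lborel. \<eta> z * g z) = (LINT z:\<Omega>|lborel. \<eta> z * (\<delta> z ^ k * h z))" by blast
  have "2 * s0 / 3 < s0" using s0 by simp
  from raise_power[OF h(1) this h(2), of k] obtain h' where "smooth_up_to_boundary \<Omega> h'"
    "\<And>z. z \<in> \<Omega> \<Longrightarrow> infdist z (frontier \<Omega>) > 2 * s0 / 3 \<Longrightarrow> h' z = 0"
    "\<And>\<eta>. set_integrable lborel \<Omega> \<eta> \<Longrightarrow> holomorphic_on_vec \<eta> \<Omega> \<Longrightarrow>
      (LINT z:\<Omega>|lborel. \<eta> z * (\<delta> z ^ k * h z)) = (LINT z:\<Omega>|lborel. \<eta> z * (\<delta> z ^ Suc k * h' z))" by blast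
  with h(3) show ?case by (intro exI[of _ h']) (simp del: power_Suc)
qed

end

theorem theorem1p2:
  fixes \<Omega> U :: "(complex ^ 'n) set"
    and \<delta> g :: "complex ^ 'n \<Rightarrow> complex"
    and k :: nat
  assumes "smooth_bounded_domain \<Omega>"
    and "smooth_up_to_boundary \<Omega> \<delta>"
    and "open U" and "frontier \<Omega> \<subseteq> U"
    and "\<And>z. z \<in> \<Omega> \<inter> U \<Longrightarrow> \<delta> z = of_real (infdist z (frontier \<Omega>))"
    and "k \<ge> 1"
    and "smooth_up_to_boundary \<Omega> g"
  shows "\<exists>\<omega> :: complex ^ 'n \<Rightarrow> complex. smooth_up_to_boundary \<Omega> \<omega> \<and>
    (\<forall>\<eta>. set_integrable lborel \<Omega> \<eta> \<and> holomorphic_on_vec \<eta> \<Omega> \<longrightarrow>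
      (LINT z:\<Omega>|lborel. \<eta> z * g z) = (LINT z:\<Omega>|lborel. \<delta> z ^ k * \<omega> z * \<eta> z))"
proof -
  have \<Omega>: "open \<Omega>" "bounded \<Omega>" "\<Omega> \<noteq> {}"
    using assms(1) by (auto simp: smooth_bounded_domain_def)
  \<comment> \<open>A nonempty frontier matters because \<open>infdist\<close> to the empty set is 0
    by convention, so it would not be a distance at all.\<close>
  have "\<Omega> \<noteq> UNIV" using \<Omega>(2) not_bounded_UNIV[where 'a = "complex ^ 'n"] by blast
  then have ne: "frontier \<Omega> \<noteq> {}" using \<Omega>(3) frontier_eq_empty by blast
  \<comment> \<open>Compactness of the frontier gives the neighbourhood \<open>U\<close> a collar of
    uniform width.\<close>
  obtain s0 where s0: "s0 > 0" "(\<Union>x\<in>frontier \<Omega>. ball x s0) \<subseteq> U"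
    using compact_subset_open_imp_ball_epsilon_subset[OF compact_frontier_bounded[OF \<Omega>(2)] assms(3,4)] by blast
  have delta_eq: "\<delta> z = of_real (infdist z (frontier \<Omega>))" if z: "z \<in> \<Omega>" "infdist z (frontier \<Omega>) < s0" for z
  proof -
    obtain p where "p \<in> frontier \<Omega>" "infdist z (frontier \<Omega>) = dist z p"
      using infdist_eq_dist_closest[OF frontier_closed ne] by blast
    then have "z \<in> (\<Union>x\<in>frontier \<Omega>. ball x s0)" using z(2) by (auto simp: dist_commute)
    then have "z \<in> U" using s0(2) by blast
    then show ?thesis using assms(5) z(1) by simp
  qed
  from integral_eq_integral_delta_power[OF \<Omega>(1,2) assms(2) s0(1) delta_eq ne assms(7)]
  obtain h where h: "smooth_up_to_boundary \<Omega> h"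
    "\<And>\<eta>. set_integrable lborel \<Omega> \<eta> \<Longrightarrow> holomorphic_on_vec \<eta> \<Omega> \<Longrightarrow>
      (LINT z:\<Omega>|lborel. \<eta> z * g z) = (LINT z:\<Omega>|lborel. \<eta> z * (\<delta> z ^ k * h z))" by blast
  then show ?thesis by (intro exI[of _ h]) (simp add: mult_ac)
qed

end
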